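(* There exist a finite alphabet $\Sigma$ and a computable infinite word $W\in\Sigma^\infty$ such that $W$ is prefix decidable but not Büchi decidable; that is, the prefix realizability problem $\mathrm{R}_p(W)$ is decidable, while the Büchi realizability problem $\mathrm{R}_p^\infty(W)$ is undecidable.
   Context: An infinite word over a finite alphabet $\Sigma$ is a sequence $W=w_1w_2\ldots w_n\ldots$ of symbols of $\Sigma$; $\Sigma^\infty$ is the set of infinite words. $W$ is computable if the function $n\mapsto w_n$ is computable. $\mathrm{Pref}(W)\subseteq\Sigma^*$ is the set of all finite prefixes $w_1\ldots w_n$ of $W$. The prefix realizability problem $\mathrm{R}_p(W)$: given a regular language $R\subseteq\Sigma^*$ (described by a deterministic finite automaton recognizing it), decide whether $R\cap\mathrm{Pref}(W)\neq\varnothing$. The Büchi realizability problem $\mathrm{R}_p^\infty(W)$: given such an $R$, decide whether $|R\cap\mathrm{Pref}(W)|=\infty$. $W$ is called prefix decidable if $\mathrm{R}_p(W)$ is decidable and Büchi decidable if $\mathrm{R}_p^\infty(W)$ is decidable. *)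

theory Defs
  imports Main "HOL-Library.Nat_Bijection" "HOL-Library.Omega_Words_Fun"
begin

section \<open>Partial recursive functions\<close>

text \<open>
  Programs carry no explicit arity. The arity of every subprogram is determined by the length of
  the argument list it is run on: composition passes one argument per inner function, primitive
  recursion and minimization work on the first argument. Restricted to argument lists of a fixed
  length, the relation below computes exactly the partial recursive functions of that arity.
\<close>

datatype recf =
    Zero
  | Succ
  | Proj nat
  | Comp recf "recf list"
  | PrimRec recf recf
  | Mu recf

text \<open>\<open>computes p xs y\<close>: the program \<open>p\<close> halts on the arguments \<open>xs\<close> with result \<open>y\<close>.\<close>

inductive computes :: "recf \<Rightarrow> nat list \<Rightarrow> nat \<Rightarrow> bool" where
  computes_Zero: "computes Zero xs 0"
| computes_Succ: "computes Succ [x] (Suc x)"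
| computes_Proj: "i < length xs \<Longrightarrow> computes (Proj i) xs (xs ! i)"
| computes_Comp:
    "list_all2 (\<lambda>g y. computes g xs y) gs ys \<Longrightarrow> computes f ys z \<Longrightarrow> computes (Comp f gs) xs z"
| computes_PrimRec_0: "computes f xs z \<Longrightarrow> computes (PrimRec f g) (0 # xs) z"
| computes_PrimRec_Suc:
    "computes (PrimRec f g) (n # xs) y \<Longrightarrow> computes g (n # y # xs) z \<Longrightarrow>
      computes (PrimRec f g) (Suc n # xs) z"
| computes_Mu:
    "computes f (n # xs) 0 \<Longrightarrow> (\<forall>m<n. \<exists>y. computes f (m # xs) (Suc y)) \<Longrightarrow>
      computes (Mu f) xs n"

inductive_cases computes_elims:
  "computes Zero xs y"
  "computes Succ xs y"
  "computes (Proj i) xs y"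
  "computes (Comp f gs) xs y"
  "computes (PrimRec f g) (0 # xs) y"
  "computes (PrimRec f g) (Suc n # xs) y"
  "computes (Mu f) xs y"

lemma computes_deterministic: "computes p xs y \<Longrightarrow> computes p xs z \<Longrightarrow> y = z"
proof (induction arbitrary: z rule: computes.induct)
  case (computes_Zero xs)
  then show ?case by (rule computes_elims(1)) simp
next
  case (computes_Succ x)
  then show ?case by (rule computes_elims(2)) simp
next
  case (computes_Proj i xs)
  from computes_Proj.prems show ?case by (rule computes_elims(3)) simp
next
  case (computes_Comp xs gs ys f v)
  from computes_Comp.prems obtain ys' where
    ys': "list_all2 (\<lambda>g y. computes g xs y) gs ys'" "computes f ys' z"
    by (rule computes_elims(4))
  have "ys = ys'"
  proof (rule nth_equalityI)
    show "length ys = length ys'"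
      using computes_Comp.IH(1) ys'(1) by (simp add: list_all2_lengthD[symmetric])
    fix i assume i: "i < length ys"
    then have "i < length gs" using computes_Comp.IH(1) by (simp add: list_all2_lengthD)
    then show "ys ! i = ys' ! i"
      using list_all2_nthD[OF computes_Comp.IH(1)] list_all2_nthD[OF ys'(1)] by blast
  qed
  then show ?case using computes_Comp.IH(2) ys'(2) by blast
next
  case (computes_PrimRec_0 f xs v g)
  from computes_PrimRec_0.prems have "computes f xs z" by (rule computes_elims(5))
  then show ?case by (rule computes_PrimRec_0.IH)
next
  case (computes_PrimRec_Suc f g n xs y v)
  from computes_PrimRec_Suc.prems obtain y' where
    y': "computes (PrimRec f g) (n # xs) y'" "computes g (n # y' # xs) z"
    by (rule computes_elims(6))
  from computes_PrimRec_Suc.IH(1)[OF y'(1)] y'(2) have "computes g (n # y # xs) z" by simp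
  then show ?case by (rule computes_PrimRec_Suc.IH(2))
next
  case (computes_Mu f n xs)
  from computes_Mu.prems have z: "computes f (z # xs) 0" "\<forall>m<z. \<exists>y. computes f (m # xs) (Suc y)"
    by (blast elim: computes_elims(7))+
  have "\<not> z < n"
  proof
    assume "z < n"
    with computes_Mu.IH(2) z(1) have "\<exists>y. Suc y = 0" by blast
    then show False by simp
  qed
  moreover have "\<not> n < z"
  proof
    assume "n < z"
    with z(2) obtain y where "computes f (n # xs) (Suc y)" by blast
    from computes_Mu.IH(1)[OF this] show False by simp
  qed
  ultimately show ?case by simp
qed

definition computable :: "(nat \<Rightarrow> nat) \<Rightarrow> bool" where
  "computable f \<longleftrightarrow> (\<exists>p. \<forall>n. computes p [n] (f n))"

definition decidable :: "nat set \<Rightarrow> bool" where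
  "decidable X \<longleftrightarrow> computable (\<lambda>n. if n \<in> X then 1 else 0)"


section \<open>Deterministic finite automata\<close>

text \<open>
  The states are \<open>0, \<dots>, length (dfa_trans A) - 1\<close>, the letters are \<open>0, \<dots>, k - 1\<close>, and
  \<open>dfa_trans A ! q ! a\<close> is the successor of the state \<open>q\<close> under the letter \<open>a\<close>.
\<close>

record dfa =
  dfa_init :: nat
  dfa_trans :: "nat list list"
  dfa_accepting :: "nat list"

definition is_dfa :: "nat \<Rightarrow> dfa \<Rightarrow> bool" where
  "is_dfa k A \<longleftrightarrow>
     dfa_init A < length (dfa_trans A) \<and>
     (\<forall>row \<in> set (dfa_trans A). length row = k \<and> set row \<subseteq> {..<length (dfa_trans A)}) \<and>
     set (dfa_accepting A) \<subseteq> {..<length (dfa_trans A)}"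

definition dfa_run :: "dfa \<Rightarrow> nat list \<Rightarrow> nat" where
  "dfa_run A w = foldl (\<lambda>q a. dfa_trans A ! q ! a) (dfa_init A) w"

definition dfa_language :: "nat \<Rightarrow> dfa \<Rightarrow> nat list set" where
  "dfa_language k A = {w. set w \<subseteq> {..<k} \<and> dfa_run A w \<in> set (dfa_accepting A)}"

definition dfa_encode :: "dfa \<Rightarrow> nat" where
  "dfa_encode A =
     prod_encode (dfa_init A,
       prod_encode (list_encode (map list_encode (dfa_trans A)), list_encode (dfa_accepting A)))"

lemma inj_dfa_encode: "inj dfa_encode"
proof (rule injI)
  fix A B :: dfa
  assume "dfa_encode A = dfa_encode B"
  then have "dfa_init A = dfa_init B"
    "map list_encode (dfa_trans A) = map list_encode (dfa_trans B)"
    "dfa_accepting A = dfa_accepting B"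
    by (auto simp: dfa_encode_def prod_encode_eq list_encode_eq)
  moreover have "dfa_trans A = dfa_trans B"
    using calculation(2) by (simp add: inj_list_encode inj_map_eq_map)
  ultimately show "A = B" by simp
qed


section \<open>Realizability problems\<close>

text \<open>Prefixes include the empty word; positions of infinite words are counted from 0.\<close>

definition Pref :: "'a word \<Rightarrow> 'a list set" where
  "Pref W = {prefix n W | n. True}"

text \<open>
  Both problems are taken over the alphabet \<open>{..<k}\<close>; the instances are automata, given by their
  codes, and numbers that are not codes of automata count as negative instances.
\<close>

definition prefix_realizability :: "nat \<Rightarrow> nat word \<Rightarrow> dfa set" where
  "prefix_realizability k W = {A. is_dfa k A \<and> dfa_language k A \<inter> Pref W \<noteq> {}}"

definition buchi_realizability :: "nat \<Rightarrow> nat word \<Rightarrow> dfa set" where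
  "buchi_realizability k W = {A. is_dfa k A \<and> infinite (dfa_language k A \<inter> Pref W)}"

definition prefix_decidable :: "nat \<Rightarrow> nat word \<Rightarrow> bool" where
  "prefix_decidable k W \<longleftrightarrow> decidable (dfa_encode ` prefix_realizability k W)"

definition buchi_decidable :: "nat \<Rightarrow> nat word \<Rightarrow> bool" where
  "buchi_decidable k W \<longleftrightarrow> decidable (dfa_encode ` buchi_realizability k W)"

end

theory Submission
  imports Defs
begin

text \<open>
  The word is a concatenation of blocks \<open>0\<^sup>n 1\<close>, built in stages from a computable enumeration of an
  undecidable set \<open>K\<close>. At stage \<open>s\<close> the blocks \<open>n < s\<close> that have been found to lie in \<open>K\<close> within \<open>s\<close>
  steps are forbidden from then on, and every block that is never forbidden is written infinitely
  often. An automaton that recognizes the end of the block \<open>n\<close> then accepts infinitely many prefixes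
  iff \<open>n\<close> is not in \<open>K\<close>. Moreover, at stage \<open>s\<close> the word is prolonged so that the automaton with
  code \<open>s\<close> accepts a prefix, whenever this is possible without forbidden blocks. The constraints only
  get tighter later, so stage \<open>s\<close> decides whether this automaton ever accepts a prefix.
\<close>

section \<open>Closure properties of computable functions\<close>

text \<open>The search at stage \<open>s\<close> has to end even if no permitted extension is
  accepted. This rests on only finitely many blocks being forbidden at stage \<open>s\<close>: the
  permitted continuations are then recognized by a finite graph, and failure has a finite
  certificate. A stage therefore looks for a pair of a prolongation and a certificate. That a pair
  exists is proved classically, and unbounded minimization finds it, so no graph search has to be
  programmed. A stage never gets stuck, whatever has been forbidden: an unfinished block can always
  be prolonged by zeros until it is long enough to be allowed. The two problems differ because
  acceptance of some prefix by the automaton \<open>a\<close> is settled on the finite piece written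
  up to stage \<open>a\<close>, whereas a block may be forbidden after arbitrarily many occurrences.
  \<open>K\<close> consists of the programs that return 0 on their own code. Instead of a universal
  program, a Horn system for evaluation is used: its derivations are lists that can be checked with
  bounded quantifiers.\<close>

named_theorems computable_intros

abbreviation pair :: "nat \<Rightarrow> nat \<Rightarrow> nat" where
  "pair a b \<equiv> prod_encode (a, b)"

abbreviation pfst :: "nat \<Rightarrow> nat" where
  "pfst z \<equiv> fst (prod_decode z)"

abbreviation psnd :: "nat \<Rightarrow> nat" where
  "psnd z \<equiv> snd (prod_decode z)"

section \<open>Composition, arithmetic and Cantor pairing\<close>

lemma computes_Comp1: "computes g xs a \<Longrightarrow> computes f [a] z \<Longrightarrow> computes (Comp f [g]) xs z"
  by (rule computes_Comp[of _ _ "[a]"]) simp_all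

lemma computes_Comp2:
  "computes g xs a \<Longrightarrow> computes h xs b \<Longrightarrow> computes f [a, b] z \<Longrightarrow> computes (Comp f [g, h]) xs z"
  by (rule computes_Comp[of _ _ "[a, b]"]) simp_all

lemma computes_Proj0: "computes (Proj 0) (x # xs) x"
  using computes_Proj[of 0 "x # xs"] by simp

lemma computes_Proj1: "computes (Proj (Suc 0)) (x # y # xs) y"
  using computes_Proj[of "Suc 0" "x # y # xs"] by simp

lemma computes_Proj2: "computes (Proj (Suc (Suc 0))) (x # y # z # xs) z"
  using computes_Proj[of "Suc (Suc 0)" "x # y # z # xs"] by simp

lemmas computes_Projs = computes_Proj0 computes_Proj1 computes_Proj2

lemma computable_binary:
  assumes "\<exists>p. \<forall>x y. computes p [x, y] (h x y)" "computable f" "computable g"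
  shows "computable (\<lambda>x. h (f x) (g x))"
proof -
  obtain p pf pg where "\<And>x y. computes p [x, y] (h x y)"
    "\<And>x. computes pf [x] (f x)" "\<And>x. computes pg [x] (g x)"
    using assms unfolding computable_def by metis
  then have "computes (Comp p [pf, pg]) [x] (h (f x) (g x))" for x
    by (blast intro: computes_Comp2)
  then show ?thesis unfolding computable_def by blast
qed

lemma computable_id [computable_intros]: "computable (\<lambda>x. x)"
  unfolding computable_def using computes_Proj0 by blast

lemma computable_comp:
  assumes "computable h" "computable f"
  shows "computable (\<lambda>x. h (f x))"
proof -
  obtain p pf where "\<And>x. computes p [x] (h x)" "\<And>x. computes pf [x] (f x)"
    using assms unfolding computable_def by metis
  then have "computes (Comp p [pf]) [x] (h (f x))" for x
    by (blast intro: computes_Comp1)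
  then show ?thesis unfolding computable_def by blast
qed

lemma computable_Suc [computable_intros]: "computable f \<Longrightarrow> computable (\<lambda>x. Suc (f x))"
  by (rule computable_comp[of Suc]) (auto simp: computable_def intro: computes_Succ)

lemma computable_zero [computable_intros]: "computable (\<lambda>x. 0)"
  unfolding computable_def using computes_Zero by blast

lemma computable_const [computable_intros]: "computable (\<lambda>x. c)"
  by (induction c) (auto intro: computable_intros)

lemma computes_add: "computes (PrimRec (Proj 0) (Comp Succ [Proj (Suc 0)])) [n, x] (n + x)"
proof (induction n)
  case 0
  then show ?case by (auto intro: computes.intros computes_Projs)
next
  case (Suc n)
  then show ?case
    by (auto intro!: computes_PrimRec_Suc[OF Suc] computes_Comp1 computes_Projs computes_Succ)
qed

lemma computable_add [computable_intros]:
  "computable f \<Longrightarrow> computable g \<Longrightarrow> computable (\<lambda>x. f x + g x)"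
  by (rule computable_binary) (use computes_add in blast)+

lemma computes_pred: "computes (PrimRec Zero (Proj 0)) [n] (n - 1)"
proof (induction n)
  case 0
  then show ?case by (auto intro: computes.intros)
next
  case (Suc n)
  then show ?case
    using computes_PrimRec_Suc[OF Suc computes_Proj0] by simp
qed

text \<open>Primitive recursion runs on the first argument, so the subtrahend comes first;
  \<open>computable_diff\<close> swaps the two back.\<close>

lemma computes_diff:
  "computes (PrimRec (Proj 0) (Comp (PrimRec Zero (Proj 0)) [Proj (Suc 0)])) [n, x] (x - n)"
proof (induction n)
  case 0
  then show ?case by (auto intro: computes.intros computes_Projs)
next
  case (Suc n)
  have "computes (Comp (PrimRec Zero (Proj 0)) [Proj (Suc 0)]) [n, x - n, x] (x - n - 1)"
    by (rule computes_Comp1[OF computes_Proj1 computes_pred])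
  from computes_PrimRec_Suc[OF Suc this] show ?case by simp
qed

lemma computable_diff [computable_intros]:
  "computable f \<Longrightarrow> computable g \<Longrightarrow> computable (\<lambda>x. f x - g x)"
  using computable_binary[of "\<lambda>n x. x - n" g f] computes_diff by blast

lemma computes_triangle:
  "computes (PrimRec Zero (Comp (PrimRec (Proj 0) (Comp Succ [Proj (Suc 0)]))
      [Proj (Suc 0), Comp Succ [Proj 0]])) [n] (triangle n)"
proof (induction n)
  case 0
  then show ?case by (auto intro: computes.intros)
next
  case (Suc n)
  have "computes (Comp (PrimRec (Proj 0) (Comp Succ [Proj (Suc 0)]))
      [Proj (Suc 0), Comp Succ [Proj 0]]) [n, triangle n] (triangle n + Suc n)"
    by (rule computes_Comp2 computes_Comp1 computes_Projs computes_Succ computes_add)+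
  from computes_PrimRec_Suc[OF Suc this] show ?case by simp
qed

lemma computes_pair: "\<exists>p. \<forall>x y. computes p [x, y] (pair x y)"
proof -
  obtain t where t: "\<And>x. computes t [x] (triangle x)"
    using computes_triangle by blast
  have "computes (Comp (PrimRec (Proj 0) (Comp Succ [Proj (Suc 0)]))
      [Comp t [PrimRec (Proj 0) (Comp Succ [Proj (Suc 0)])], Proj 0]) [x, y] (pair x y)" for x y
    using computes_Comp2[OF computes_Comp1[OF computes_add t] computes_Proj0 computes_add]
    by (simp add: prod_encode_def)
  then show ?thesis by blast
qed

lemma computable_triangle: "computable f \<Longrightarrow> computable (\<lambda>x. triangle (f x))"
  by (rule computable_comp[of triangle]) (use computes_triangle in \<open>auto simp: computable_def\<close>)

lemma computable_pair [computable_intros]: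
  "computable f \<Longrightarrow> computable g \<Longrightarrow> computable (\<lambda>x. pair (f x) (g x))"
  by (rule computable_binary[OF computes_pair])

text \<open>The diagonal on which \<open>z\<close> lies is the least \<open>t\<close> with \<open>z < triangle (Suc t)\<close>.\<close>

lemma computable_diagonal:
  "computable (\<lambda>z. pfst z + psnd z)"
proof -
  obtain s where s: "\<And>x. computes s [x] (triangle (Suc x))"
    using computable_triangle[OF computable_Suc[OF computable_id]] by (auto simp: computable_def)
  \<comment> \<open>Truncated subtraction vanishes exactly when \<open>z < triangle (Suc t)\<close>,
    which gives the zero test that \<open>Mu\<close> needs.\<close>
  let ?q = "Comp (PrimRec (Proj 0) (Comp (PrimRec Zero (Proj 0)) [Proj (Suc 0)]))
      [Comp s [Proj 0], Comp Succ [Proj (Suc 0)]]"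
  have q: "computes ?q [t, z] (Suc z - triangle (Suc t))" for t z
    by (rule computes_Comp2 computes_Comp1 computes_Projs computes_Succ computes_diff s)+
  have "computes (Mu ?q) [z] (pfst z + psnd z)" for z
  proof -
    obtain a b where z: "z = pair a b" by (metis prod_decode_inverse surj_pair)
    have z': "z = triangle (a + b) + a" using z by (simp add: prod_encode_def)
    have "computes ?q [a + b, z] 0"
      using q[of "a + b" z] z' by simp
    moreover have "\<exists>y. computes ?q [m, z] (Suc y)" if "m < a + b" for m
    proof -
      have "triangle (Suc m) \<le> triangle (a + b)"
        using that unfolding triangle_def by (intro div_le_mono mult_le_mono) auto
      then obtain y where "Suc z - triangle (Suc m) = Suc y"
        using z' by (metis Suc_diff_le le_add1 le_trans)
      then show ?thesis using q[of m z] by metis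
    qed
    ultimately show ?thesis
      using computes_Mu[of ?q "a + b" "[z]"] z by simp
  qed
  then show ?thesis unfolding computable_def by blast
qed

lemma computable_pfst [computable_intros]:
  assumes "computable f"
  shows "computable (\<lambda>x. pfst (f x))"
proof -
  have "z - triangle (pfst z + psnd z) = pfst z" for z
  proof -
    obtain a b where z: "z = pair a b" by (metis prod_decode_inverse surj_pair)
    have "pair a b - triangle (a + b) = a" by (simp add: prod_encode_def)
    then show ?thesis by (simp add: z)
  qed
  then have "computable pfst"
    using computable_diff[OF computable_id computable_triangle[OF computable_diagonal]] by simp
  then show ?thesis using computable_comp assms by blast
qed

lemma computable_psnd [computable_intros]:
  assumes "computable f"
  shows "computable (\<lambda>x. psnd (f x))"
proof -
  have "computable (\<lambda>z. (pfst z + psnd z) - pfst z)"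
    by (intro computable_intros computable_diagonal)
  then have "computable (\<lambda>z. psnd z)" by simp
  then show ?thesis using computable_comp assms by blast
qed

text \<open>
  A function of several variables is represented by a function of a paired environment: the rules
  for binders below replace the bound variables by projections.
\<close>

lemma computable_rec_nat [computable_intros]:
  assumes f: "computable f"
    and g: "computable (\<lambda>e. g (pfst e) (pfst (psnd e)) (psnd (psnd e)))"
    and h: "computable h"
  shows "computable (\<lambda>x. rec_nat (f x) (\<lambda>n r. g x n r) (h x))"
proof (rule computable_binary[where h = "\<lambda>n x. rec_nat (f x) (g x) n", OF _ h computable_id])
  obtain pf pg where pf: "\<And>x. computes pf [x] (f x)"
    and pg: "\<And>e. computes pg [e] (g (pfst e) (pfst (psnd e)) (psnd (psnd e)))"
    using f g unfolding computable_def by metis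
  obtain pp where pp: "\<And>x y. computes pp [x, y] (pair x y)" using computes_pair by blast
  let ?q = "Comp pg [Comp pp [Proj (Suc (Suc 0)), Comp pp [Proj 0, Proj (Suc 0)]]]"
  have q: "computes ?q [n, r, x] (g x n r)" for n r x
  proof (rule computes_Comp1)
    show "computes (Comp pp [Proj (Suc (Suc 0)), Comp pp [Proj 0, Proj (Suc 0)]]) [n, r, x]
        (pair x (pair n r))"
      by (rule computes_Comp2 computes_Projs pp)+
    show "computes pg [pair x (pair n r)] (g x n r)"
      using pg[of "pair x (pair n r)"] by simp
  qed
  have "computes (PrimRec pf ?q) [n, x] (rec_nat (f x) (g x) n)" for n x
    by (induction n) (auto intro: computes_PrimRec_0 computes_PrimRec_Suc pf q)
  then show "\<exists>p. \<forall>n x. computes p [n, x] (rec_nat (f x) (g x) n)" by blast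
qed

section \<open>Computable predicates, bounded quantifiers and unbounded search\<close>

definition computable_pred :: "(nat \<Rightarrow> bool) \<Rightarrow> bool" where
  "computable_pred P \<longleftrightarrow> computable (\<lambda>x. if P x then 1 else 0)"

lemma computable_pred_comp:
  "computable_pred P \<Longrightarrow> computable f \<Longrightarrow> computable_pred (\<lambda>x. P (f x))"
  unfolding computable_pred_def by (rule computable_comp)

text \<open>A case distinction is a recursion of length 0 or 1 along the characteristic
  function.\<close>

lemma computable_if [computable_intros]:
  assumes "computable_pred P" "computable f" "computable g"
  shows "computable (\<lambda>x. if P x then f x else g x)"
proof -
  have "computable (\<lambda>x. rec_nat (g x) (\<lambda>_ _. f x) (if P x then 1 else 0))"
    using assms unfolding computable_pred_def
    by (intro computable_intros computable_comp[OF assms(2)])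
  moreover have "(\<lambda>x. rec_nat (g x) (\<lambda>_ _. f x) (if P x then 1 else 0)) =
      (\<lambda>x. if P x then f x else g x)" by auto
  ultimately show ?thesis by simp
qed

lemma computable_pred_conj [computable_intros]:
  assumes "computable_pred P" "computable_pred Q"
  shows "computable_pred (\<lambda>x. P x \<and> Q x)"
proof -
  have "computable (\<lambda>x. if P x then if Q x then 1 else 0 else 0)"
    by (intro computable_intros assms)
  then show ?thesis unfolding computable_pred_def
    by (rule back_subst[of computable]) auto
qed

lemma computable_pred_not [computable_intros]:
  assumes "computable_pred P"
  shows "computable_pred (\<lambda>x. \<not> P x)"
proof -
  have "computable (\<lambda>x. if P x then 0 else 1)"
    by (intro computable_intros assms)
  then show ?thesis unfolding computable_pred_def
    by (rule back_subst[of computable]) auto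
qed

lemma computable_pred_disj [computable_intros]:
  assumes "computable_pred P" "computable_pred Q"
  shows "computable_pred (\<lambda>x. P x \<or> Q x)"
proof -
  have "computable_pred (\<lambda>x. \<not> (\<not> P x \<and> \<not> Q x))"
    by (intro computable_intros assms)
  then show ?thesis by simp
qed

lemma computable_pred_imp [computable_intros]:
  assumes "computable_pred P" "computable_pred Q"
  shows "computable_pred (\<lambda>x. P x \<longrightarrow> Q x)"
proof -
  have "computable_pred (\<lambda>x. \<not> (P x \<and> \<not> Q x))"
    by (intro computable_intros assms)
  then show ?thesis by simp
qed

lemma computable_pred_less [computable_intros]:
  assumes "computable f" "computable g"
  shows "computable_pred (\<lambda>x. f x < g x)"
proof -
  have "computable (\<lambda>x. Suc 0 - (Suc 0 - (g x - f x)))"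
    by (intro computable_intros assms)
  then show ?thesis unfolding computable_pred_def
    by (rule back_subst[of computable]) auto
qed

lemma computable_pred_le [computable_intros]:
  assumes "computable f" "computable g"
  shows "computable_pred (\<lambda>x. f x \<le> g x)"
proof -
  have "computable_pred (\<lambda>x. \<not> (g x < f x))"
    by (intro computable_intros assms)
  then show ?thesis by (simp add: not_less)
qed

lemma computable_pred_eq [computable_intros]:
  fixes f g :: "nat \<Rightarrow> nat"
  assumes "computable f" "computable g"
  shows "computable_pred (\<lambda>x. f x = g x)"
proof -
  have "computable_pred (\<lambda>x. f x \<le> g x \<and> g x \<le> f x)"
    by (intro computable_intros assms)
  then show ?thesis by (simp add: eq_iff)
qed

lemma computable_pred_ex [computable_intros]:
  assumes P: "computable_pred (\<lambda>e. P (pfst e) (psnd e))" and f: "computable f"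
  shows "computable_pred (\<lambda>x. \<exists>y<f x. P x y)"
proof -
  have "computable_pred (\<lambda>e. P (pfst e) (pfst (psnd e)))"
    using computable_pred_comp[OF P computable_pair[OF computable_pfst[OF computable_id]
        computable_pfst[OF computable_psnd[OF computable_id]]]]
    by simp
  then have "computable (\<lambda>x. rec_nat 0 (\<lambda>n r. if P x n then 1 else r) (f x))"
    by (intro computable_intros f)
  moreover have "rec_nat (0 :: nat) (\<lambda>n r. if P x n then 1 else r) m = (if \<exists>y<m. P x y then 1 else 0)"
    for x m by (induction m) (auto simp: less_Suc_eq)
  ultimately show ?thesis unfolding computable_pred_def by (simp only:)
qed

lemma computable_pred_all [computable_intros]:
  assumes P: "computable_pred (\<lambda>e. P (pfst e) (psnd e))" and f: "computable f"
  shows "computable_pred (\<lambda>x. \<forall>y<f x. P x y)"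
proof -
  have "computable_pred (\<lambda>x. \<not> (\<exists>y<f x. \<not> P x y))"
    by (intro computable_intros assms)
  then show ?thesis by simp
qed

text \<open>Only the truth of the existence statement matters, not a bound or a construction. This
  is what later allows stages to be defined by \<open>LEAST\<close> with a classical proof that a
  witness exists.\<close>

lemma computable_Least:
  assumes P: "computable_pred (\<lambda>e. P (pfst e) (psnd e))" and ex: "\<And>x. \<exists>y. P x y"
  shows "computable (\<lambda>x. LEAST y. P x y)"
proof -
  \<comment> \<open>\<open>Mu\<close> puts the searched variable in front and looks for the value 0,
    hence the swapped projections and the inverted truth value.\<close>
  have "computable (\<lambda>e. if P (psnd e) (pfst e) then 0 else 1)"
    using computable_pred_comp[OF P computable_pair[OF computable_psnd[OF computable_id]
        computable_pfst[OF computable_id]]]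
    by (intro computable_intros) simp_all
  then obtain p where p: "\<And>e. computes p [e] (if P (psnd e) (pfst e) then 0 else 1)"
    unfolding computable_def by blast
  obtain pp where pp: "\<And>x y. computes pp [x, y] (pair x y)" using computes_pair by blast
  have q: "computes (Comp p [pp]) [y, x] (if P x y then 0 else 1)" for x y
    using computes_Comp1[OF pp p[of "pair y x"]] by simp
  have "computes (Mu (Comp p [pp])) [x] (LEAST y. P x y)" for x
  proof (rule computes_Mu)
    show "computes (Comp p [pp]) [LEAST y. P x y, x] 0"
      using q[of "LEAST y. P x y" x] LeastI_ex[OF ex[of x]] by simp
    show "\<forall>m<LEAST y. P x y. \<exists>y. computes (Comp p [pp]) [m, x] (Suc y)"
    proof (intro allI impI exI)
      fix m assume "m < (LEAST y. P x y)"
      then have "\<not> P x m" by (rule not_less_Least)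
      then show "computes (Comp p [pp]) [m, x] (Suc 0)" using q[of m x] by simp
    qed
  qed
  then show ?thesis unfolding computable_def by blast
qed

lemma computable_min [computable_intros]:
  "computable f \<Longrightarrow> computable g \<Longrightarrow> computable (\<lambda>x. min (f x) (g x))"
  unfolding min_def by (intro computable_intros)

section \<open>Coded lists\<close>

definition len :: "nat \<Rightarrow> nat" where
  "len c = length (list_decode c)"

text \<open>With the default 0, \<open>el c\<close> is an infinite word, so that notions for
  infinite words apply directly to coded finite ones.\<close>

definition el :: "nat \<Rightarrow> nat \<Rightarrow> nat" where
  "el c i = (if i < len c then list_decode c ! i else 0)"

abbreviation cons :: "nat \<Rightarrow> nat \<Rightarrow> nat" where
  "cons a c \<equiv> Suc (pair a c)"

lemma len_list_encode [simp]: "len (list_encode xs) = length xs"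
  by (simp add: len_def)

lemma el_list_encode: "el (list_encode xs) i = (if i < length xs then xs ! i else 0)"
  by (simp add: el_def)

lemma list_decode_tl: "list_decode (psnd (c - 1)) = tl (list_decode c)"
proof (cases c)
  \<comment> \<open>The empty list has code 0, and both \<open>0 - 1\<close> and
    \<open>psnd 0\<close> are 0: tails can be taken beyond the end of the list.\<close>
  case 0
  have "pair 0 0 = 0" by (simp add: prod_encode_def)
  then have "psnd 0 = 0" by (metis prod_encode_inverse snd_conv)
  with 0 show ?thesis by simp
next
  case (Suc n)
  then show ?thesis by (simp split: prod.split)
qed

lemma list_decode_drop:
  "list_decode (rec_nat c (\<lambda>_ r. psnd (r - 1)) i) = drop i (list_decode c)"
  by (induction i) (simp_all add: list_decode_tl drop_Suc tl_drop del: One_nat_def)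

lemma computable_len [computable_intros]:
  assumes "computable f"
  shows "computable (\<lambda>x. len (f x))"
proof -
  have z: "c = 0 \<longleftrightarrow> list_decode c = []" for c
    by (metis list_decode.simps(1) list_decode_inverse list_encode.simps(1))
  have eq: "len c = (LEAST i. rec_nat c (\<lambda>_ r. psnd (r - 1)) i = 0)" for c
    unfolding z list_decode_drop len_def
    by (rule sym, rule Least_equality) auto
  have "computable (\<lambda>c. LEAST i. rec_nat c (\<lambda>_ r. psnd (r - 1)) i = 0)"
  proof (rule computable_Least)
    show "\<exists>i. rec_nat c (\<lambda>_ r. psnd (r - 1)) i = 0" for c
      unfolding z list_decode_drop by (intro exI[of _ "len c"]) (simp add: len_def)
  qed (intro computable_intros)
  then have "computable len" by (simp add: eq[abs_def])
  from computable_comp[OF this assms] show ?thesis .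
qed

lemma computable_el [computable_intros]:
  assumes "computable f" "computable g"
  shows "computable (\<lambda>x. el (f x) (g x))"
proof -
  have "pfst (c - 1) = hd (list_decode c)" if "list_decode c \<noteq> []" for c
    using that by (cases c) (auto split: prod.split)
  then have eq: "el c i = (if i < len c then pfst (rec_nat c (\<lambda>_ r. psnd (r - 1)) i - 1) else 0)"
    for c i
    unfolding el_def len_def
    using list_decode_drop[of c i] by (auto simp: hd_drop_conv_nth)
  show ?thesis unfolding eq by (intro computable_intros assms)
qed

text \<open>Coding is bijective, so length and entries determine the code; a search for a number
  with these properties replaces a recursive construction.\<close>

lemma computable_list_encode_map_upt:
  assumes F: "computable (\<lambda>e. F (pfst e) (psnd e))" and b: "computable b"
  shows "computable (\<lambda>x. list_encode (map (F x) [0..<b x]))"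
proof -
  have eq: "list_encode (map (F x) [0..<b x]) = (LEAST c. len c = b x \<and> (\<forall>i<b x. el c i = F x i))"
    for x
  proof (rule Least_equality[symmetric])
    fix c assume c: "len c = b x \<and> (\<forall>i<b x. el c i = F x i)"
    then have "list_decode c = map (F x) [0..<b x]"
      by (intro nth_equalityI) (auto simp: len_def el_def)
    then show "list_encode (map (F x) [0..<b x]) \<le> c"
      by (metis list_decode_inverse order_refl)
  qed (simp add: el_list_encode)
  show ?thesis unfolding eq
  proof (rule computable_Least)
    show "computable_pred (\<lambda>e. len (psnd e) = b (pfst e) \<and>
        (\<forall>i<b (pfst e). el (psnd e) i = F (pfst e) i))"
      using computable_comp[OF F computable_pair[OF computable_pfst[OF computable_pfst[OF
          computable_id]] computable_psnd[OF computable_id]]]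
      by (intro computable_intros computable_comp[OF b]) simp_all
    show "\<exists>c. len c = b x \<and> (\<forall>i<b x. el c i = F x i)" for x
      by (rule exI[of _ "list_encode (map (F x) [0..<b x])"]) (simp add: el_list_encode)
  qed
qed

section \<open>A recursively enumerable undecidable set\<close>

text \<open>
  A Horn system is a function \<open>R\<close> on rule names; \<open>R e\<close> codes the conclusion and the two premises
  of the rule \<open>e\<close>. The fact \<open>0\<close> is an axiom, so that it can stand for a missing premise.
\<close>

abbreviation conclusion :: "nat \<Rightarrow> nat" where
  "conclusion r \<equiv> pfst r"

abbreviation premise1 :: "nat \<Rightarrow> nat" where
  "premise1 r \<equiv> pfst (psnd r)"

abbreviation premise2 :: "nat \<Rightarrow> nat" where
  "premise2 r \<equiv> psnd (psnd r)"

abbreviation rule3 :: "nat \<Rightarrow> nat \<Rightarrow> nat \<Rightarrow> nat" where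
  "rule3 c p q \<equiv> pair c (pair p q)"

inductive derivable :: "(nat \<Rightarrow> nat) \<Rightarrow> nat \<Rightarrow> bool" for R where
  derivable_0: "derivable R 0"
| derivable_rule: "derivable R (premise1 (R e)) \<Longrightarrow> derivable R (premise2 (R e)) \<Longrightarrow>
    derivable R (conclusion (R e))"

text \<open>A list of rule names instead of a tree: correctness is a statement with bounded
  quantifiers, hence computable.\<close>

definition derivation :: "(nat \<Rightarrow> nat) \<Rightarrow> nat \<Rightarrow> bool" where
  "derivation R c \<longleftrightarrow> (\<forall>i<len c.
     (premise1 (R (el c i)) = 0 \<or> (\<exists>j<i. conclusion (R (el c j)) = premise1 (R (el c i)))) \<and>
     (premise2 (R (el c i)) = 0 \<or> (\<exists>j<i. conclusion (R (el c j)) = premise2 (R (el c i)))))"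

definition derives :: "(nat \<Rightarrow> nat) \<Rightarrow> nat \<Rightarrow> nat \<Rightarrow> bool" where
  "derives R c x \<longleftrightarrow> derivation R c \<and> (x = 0 \<or> (\<exists>j<len c. conclusion (R (el c j)) = x))"

lemma derivable_if_derives:
  assumes "derives R c x"
  shows "derivable R x"
proof -
  have "derivable R (conclusion (R (el c i)))" if "i < len c" for i
    using that
  proof (induction i rule: less_induct)
    case (less i)
    have "derivable R p" if "p = 0 \<or> (\<exists>j<i. conclusion (R (el c j)) = p)" for p
      using that less derivable_0 by (metis less_trans)
    moreover have "derivation R c" using assms by (simp add: derives_def)
    ultimately show ?case
      using less.prems unfolding derivation_def by (blast intro: derivable_rule)
  qed
  then show ?thesis using assms derivable_0 unfolding derives_def by metis
qed

lemma el_append: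
  "el (list_encode (xs @ ys)) i =
    (if i < length xs then el (list_encode xs) i else el (list_encode ys) (i - length xs))"
  by (auto simp: el_list_encode nth_append)

text \<open>Premises refer to earlier entries by their conclusions and not by their positions, so
  the second list stays correct when it is shifted.\<close>

lemma derives_append:
  assumes "derivation R (list_encode xs)" "derives R (list_encode ys) x"
  shows "derives R (list_encode (xs @ ys)) x"
proof -
  let ?c = "\<lambda>zs i. conclusion (R (el (list_encode zs) i))"
  have shift: "\<exists>j<length xs + i. ?c (xs @ ys) j = p" if "\<exists>j<i. ?c ys j = p" for i p
  proof -
    obtain j where "j < i" "?c ys j = p" using \<open>\<exists>j<i. ?c ys j = p\<close> by blast
    then show ?thesis by (intro exI[of _ "length xs + j"]) (simp add: el_append)
  qed
  have "derivation R (list_encode (xs @ ys))"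
    unfolding derivation_def
  proof (intro allI impI)
    fix i assume i: "i < len (list_encode (xs @ ys))"
    show "(premise1 (R (el (list_encode (xs @ ys)) i)) = 0 \<or>
        (\<exists>j<i. ?c (xs @ ys) j = premise1 (R (el (list_encode (xs @ ys)) i)))) \<and>
      (premise2 (R (el (list_encode (xs @ ys)) i)) = 0 \<or>
        (\<exists>j<i. ?c (xs @ ys) j = premise2 (R (el (list_encode (xs @ ys)) i))))"
    proof (cases "i < length xs")
      case True
      have eq: "?c (xs @ ys) j = ?c xs j" if "j < i" for j
        using that True by (simp add: el_append)
      from True have "el (list_encode (xs @ ys)) i = el (list_encode xs) i"
        by (simp add: el_append)
      with True assms(1) eq show ?thesis
        unfolding derivation_def len_list_encode by metis
    next
      case False
      then obtain k where k: "i = length xs + k" using le_Suc_ex not_less by blast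
      then have "el (list_encode (xs @ ys)) i = el (list_encode ys) k"
        by (simp add: el_append)
      moreover have "k < length ys" using i k by simp
      ultimately show ?thesis
        using assms(2) shift[of k] k unfolding derives_def derivation_def len_list_encode by metis
    qed
  qed
  then show ?thesis
    using assms(2) shift[of "length ys" x] unfolding derives_def by auto
qed

text \<open>A rule is applied by concatenating derivations of its two premises and appending the
  name of the rule.\<close>

lemma derivable_iff_derives: "derivable R x \<longleftrightarrow> (\<exists>c. derives R c x)"
proof
  show "derivable R x \<Longrightarrow> \<exists>c. derives R c x"
  proof (induction rule: derivable.induct)
    case derivable_0
    have "derives R (list_encode []) 0"
      by (simp add: derives_def derivation_def len_def)
    then show ?case by blast
  next
    case (derivable_rule e)
    then obtain c1 c2 where "derives R c1 (premise1 (R e))" "derives R c2 (premise2 (R e))"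
      by blast
    then obtain xs ys where xs: "derives R (list_encode xs) (premise1 (R e))"
      and ys: "derives R (list_encode ys) (premise2 (R e))"
      by (metis list_decode_inverse)
    let ?zs = "xs @ ys"
    have p2: "derives R (list_encode ?zs) (premise2 (R e))"
      using xs ys derives_append[of R xs ys] unfolding derives_def[of R "list_encode xs"] by blast
    have p1: "premise1 (R e) = 0 \<or>
        (\<exists>j<length ?zs. conclusion (R (el (list_encode ?zs) j)) = premise1 (R e))"
      using xs unfolding derives_def by (auto simp: el_append intro: trans_less_add1)
    have last: "el (list_encode (?zs @ [e])) (length ?zs) = e"
      by (simp add: el_list_encode)
    have front: "el (list_encode (?zs @ [e])) j = el (list_encode ?zs) j" if "j < length ?zs" for j
      using that by (simp add: el_append[of ?zs "[e]"] del: append_assoc)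
    have "derivation R (list_encode (?zs @ [e]))"
      unfolding derivation_def
    proof (intro allI impI)
      fix i assume "i < len (list_encode (?zs @ [e]))"
      then have "i < length ?zs \<or> i = length ?zs" by auto
      then show "(premise1 (R (el (list_encode (?zs @ [e])) i)) = 0 \<or>
        (\<exists>j<i. conclusion (R (el (list_encode (?zs @ [e])) j)) =
          premise1 (R (el (list_encode (?zs @ [e])) i)))) \<and>
      (premise2 (R (el (list_encode (?zs @ [e])) i)) = 0 \<or>
        (\<exists>j<i. conclusion (R (el (list_encode (?zs @ [e])) j)) =
          premise2 (R (el (list_encode (?zs @ [e])) i))))"
      proof
        assume i: "i < length ?zs"
        have "\<And>j. j < i \<Longrightarrow> el (list_encode (?zs @ [e])) j = el (list_encode ?zs) j"
          using front i by simp
        with i front[OF i] p2 show ?thesis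
          unfolding derives_def derivation_def len_list_encode by metis
      next
        assume i: "i = length ?zs"
        show ?thesis
          using p1 p2 front unfolding i last derives_def len_list_encode by metis
      qed
    qed
    then have "derives R (list_encode (?zs @ [e])) (conclusion (R e))"
      using last unfolding derives_def by (metis len_list_encode length_append_singleton lessI)
    then show ?case by blast
  qed
qed (auto intro: derivable_if_derives)

lemma computable_derives [computable_intros]:
  assumes "computable R" "computable f" "computable g"
  shows "computable_pred (\<lambda>x. derives R (f x) (g x))"
proof -
  have "computable_pred (\<lambda>x. derives R (pfst x) (psnd x))"
    unfolding derives_def derivation_def
    by (intro computable_intros computable_comp[OF assms(1)])
  from computable_pred_comp[OF this computable_pair[OF assms(2,3)]] show ?thesis by simp
qed

section \<open>Evaluation of programs as a Horn system\<close>

fun recf_encode :: "recf \<Rightarrow> nat" where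
  "recf_encode Zero = pair 0 0"
| "recf_encode Succ = pair 1 0"
| "recf_encode (Proj i) = pair 2 i"
| "recf_encode (Comp f gs) = pair 3 (pair (recf_encode f) (list_encode (map recf_encode gs)))"
| "recf_encode (PrimRec f g) = pair 4 (pair (recf_encode f) (recf_encode g))"
| "recf_encode (Mu f) = pair 5 (recf_encode f)"

abbreviation fact :: "nat \<Rightarrow> nat \<Rightarrow> nat \<Rightarrow> nat" where
  "fact p x y \<equiv> pair p (pair x y)"

text \<open>
  The fact \<open>(p, x, y)\<close> says that the program with code \<open>p\<close> maps \<open>x\<close> to \<open>y\<close>. There are two further
  kinds of programs: \<open>(6, gs)\<close> evaluates a list of programs, and \<open>(7, f, m)\<close> verifies that \<open>f\<close> is
  positive at all first arguments below \<open>m\<close>. The axiom \<open>0\<close> is the true fact that \<open>Zero\<close> maps the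
  empty list to \<open>0\<close>.
\<close>

definition eval_rule :: "nat \<Rightarrow> nat" where
  "eval_rule e = (
    let t = pfst e; e1 = psnd e; a = pfst e1; e2 = psnd e1; b = pfst e2; e3 = psnd e2;
      c = pfst e3; e4 = psnd e3; d = pfst e4; e5 = psnd e4; x = pfst e5; y = psnd e5
    in if t = 0 then rule3 (fact (pair 0 0) x 0) 0 0
    else if t = 1 then rule3 (fact (pair 1 0) (cons x 0) (Suc x)) 0 0
    else if t = 2 then rule3 (fact (pair 2 0) (cons a x) a) 0 0
    else if t = 3 then rule3 (fact (pair 2 (Suc a)) (cons b x) y) (fact (pair 2 a) x y) 0
    else if t = 4 then
      rule3 (fact (pair 3 (pair a b)) x y) (fact (pair 6 b) x c) (fact a c y)
    else if t = 5 then rule3 (fact (pair 6 0) x 0) 0 0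
    else if t = 6 then
      rule3 (fact (pair 6 (cons a b)) x (cons c d)) (fact a x c) (fact (pair 6 b) x d)
    else if t = 7 then rule3 (fact (pair 4 (pair a b)) (cons 0 x) y) (fact a x y) 0
    else if t = 8 then
      rule3 (fact (pair 4 (pair a b)) (cons (Suc c) x) y)
        (fact (pair 4 (pair a b)) (cons c x) d) (fact b (cons c (cons d x)) y)
    else if t = 9 then
      rule3 (fact (pair 5 a) x y) (fact (pair 7 (pair a y)) x 0) (fact a (cons y x) 0)
    else if t = 10 then rule3 (fact (pair 7 (pair a 0)) x 0) 0 0
    else rule3 (fact (pair 7 (pair a (Suc b))) x 0)
        (fact (pair 7 (pair a b)) x 0) (fact a (cons b x) (Suc y)))"

lemma computable_eval_rule: "computable eval_rule"
  unfolding eval_rule_def Let_def by (intro computable_intros)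

abbreviation evaluates :: "nat \<Rightarrow> nat \<Rightarrow> nat \<Rightarrow> bool" where
  "evaluates p x y \<equiv> derivable eval_rule (fact p x y)"

abbreviation instance_of :: "nat \<Rightarrow> nat \<Rightarrow> nat \<Rightarrow> nat \<Rightarrow> nat \<Rightarrow> nat \<Rightarrow> nat \<Rightarrow> nat" where
  "instance_of t a b c d x y \<equiv> pair t (pair a (pair b (pair c (pair d (pair x y)))))"

lemma pair_0_0: "pair 0 0 = 0"
  by (simp add: prod_encode_def)

lemma eval_rule_simps:
  "eval_rule (instance_of 0 a b c d x y) =
    rule3 (fact (pair 0 0) x 0) 0 0"
  "eval_rule (instance_of 1 a b c d x y) =
    rule3 (fact (pair 1 0) (cons x 0) (Suc x)) 0 0"
  "eval_rule (instance_of 2 a b c d x y) =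
    rule3 (fact (pair 2 0) (cons a x) a) 0 0"
  "eval_rule (instance_of 3 a b c d x y) =
    rule3 (fact (pair 2 (Suc a)) (cons b x) y) (fact (pair 2 a) x y) 0"
  "eval_rule (instance_of 4 a b c d x y) =
    rule3 (fact (pair 3 (pair a b)) x y) (fact (pair 6 b) x c) (fact a c y)"
  "eval_rule (instance_of 5 a b c d x y) =
    rule3 (fact (pair 6 0) x 0) 0 0"
  "eval_rule (instance_of 6 a b c d x y) =
    rule3 (fact (pair 6 (cons a b)) x (cons c d)) (fact a x c) (fact (pair 6 b) x d)"
  "eval_rule (instance_of 7 a b c d x y) =
    rule3 (fact (pair 4 (pair a b)) (cons 0 x) y) (fact a x y) 0"
  "eval_rule (instance_of 8 a b c d x y) =
    rule3 (fact (pair 4 (pair a b)) (cons (Suc c) x) y)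
      (fact (pair 4 (pair a b)) (cons c x) d) (fact b (cons c (cons d x)) y)"
  "eval_rule (instance_of 9 a b c d x y) =
    rule3 (fact (pair 5 a) x y) (fact (pair 7 (pair a y)) x 0) (fact a (cons y x) 0)"
  "eval_rule (instance_of 10 a b c d x y) =
    rule3 (fact (pair 7 (pair a 0)) x 0) 0 0"
  "t > 10 \<Longrightarrow> eval_rule (instance_of t a b c d x y) =
    rule3 (fact (pair 7 (pair a (Suc b))) x 0)
      (fact (pair 7 (pair a b)) x 0) (fact a (cons b x) (Suc y))"
  by (simp_all add: eval_rule_def)

lemma evaluates_Zero:
  "evaluates (pair 0 0) x 0"
  using derivable_rule[of eval_rule "instance_of 0 a b c d x y"]
  unfolding eval_rule_simps by (simp add: derivable_0)

lemma evaluates_Succ: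
  "evaluates (pair 1 0) (cons x 0) (Suc x)"
  using derivable_rule[of eval_rule "instance_of 1 a b c d x y"]
  unfolding eval_rule_simps by (simp add: derivable_0)

lemma evaluates_Proj_0:
  "evaluates (pair 2 0) (cons a x) a"
  using derivable_rule[of eval_rule "instance_of 2 a b c d x y"]
  unfolding eval_rule_simps by (simp add: derivable_0)

lemma evaluates_Proj_Suc:
  "evaluates (pair 2 a) x y \<Longrightarrow> evaluates (pair 2 (Suc a)) (cons b x) y"
  using derivable_rule[of eval_rule "instance_of 3 a b c d x y"]
  unfolding eval_rule_simps by (simp add: derivable_0)

lemma evaluates_Comp:
  "evaluates (pair 6 b) x c \<Longrightarrow> evaluates a c y \<Longrightarrow> evaluates (pair 3 (pair a b)) x y"
  using derivable_rule[of eval_rule "instance_of 4 a b c d x y"]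
  unfolding eval_rule_simps by (simp add: derivable_0)

lemma evaluates_Nil:
  "evaluates (pair 6 0) x 0"
  using derivable_rule[of eval_rule "instance_of 5 a b c d x y"]
  unfolding eval_rule_simps by (simp add: derivable_0)

lemma evaluates_Cons:
  "evaluates a x c \<Longrightarrow> evaluates (pair 6 b) x d \<Longrightarrow> evaluates (pair 6 (cons a b)) x (cons c d)"
  using derivable_rule[of eval_rule "instance_of 6 a b c d x y"]
  unfolding eval_rule_simps by (simp add: derivable_0)

lemma evaluates_PrimRec_0:
  "evaluates a x y \<Longrightarrow> evaluates (pair 4 (pair a b)) (cons 0 x) y"
  using derivable_rule[of eval_rule "instance_of 7 a b c d x y"]
  unfolding eval_rule_simps by (simp add: derivable_0)

lemma evaluates_PrimRec_Suc:
  "evaluates (pair 4 (pair a b)) (cons c x) d \<Longrightarrow> evaluates b (cons c (cons d x)) y \<Longrightarrow>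
    evaluates (pair 4 (pair a b)) (cons (Suc c) x) y"
  using derivable_rule[of eval_rule "instance_of 8 a b c d x y"]
  unfolding eval_rule_simps by (simp add: derivable_0)

lemma evaluates_Mu:
  "evaluates (pair 7 (pair a y)) x 0 \<Longrightarrow> evaluates a (cons y x) 0 \<Longrightarrow> evaluates (pair 5 a) x y"
  using derivable_rule[of eval_rule "instance_of 9 a b c d x y"]
  unfolding eval_rule_simps by (simp add: derivable_0)

lemma evaluates_below_0:
  "evaluates (pair 7 (pair a 0)) x 0"
  using derivable_rule[of eval_rule "instance_of 10 a b c d x y"]
  unfolding eval_rule_simps by (simp add: derivable_0)

lemma evaluates_below_Suc:
  "evaluates (pair 7 (pair a b)) x 0 \<Longrightarrow> evaluates a (cons b x) (Suc y) \<Longrightarrow>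
    evaluates (pair 7 (pair a (Suc b))) x 0"
  using derivable_rule[of eval_rule "instance_of 11 a b c d x y"]
  unfolding eval_rule_simps(12)[of 11, simplified] by (simp add: derivable_0)

lemma evaluates_if_computes:
  "computes p xs y \<Longrightarrow> evaluates (recf_encode p) (list_encode xs) y"
proof (induction rule: computes.induct)
  case (computes_Zero xs)
  then show ?case using evaluates_Zero by simp
next
  case (computes_Succ x)
  then show ?case using evaluates_Succ by simp
next
  case (computes_Proj i xs)
  then show ?case
  proof (induction i arbitrary: xs)
    case 0
    then show ?case using evaluates_Proj_0 by (cases xs) simp_all
  next
    case (Suc i)
    then show ?case using evaluates_Proj_Suc by (cases xs) simp_all
  qed
next
  case (computes_Comp xs gs ys f z)
  have "evaluates (pair 6 (list_encode (map recf_encode gs))) (list_encode xs) (list_encode ys)"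
    using computes_Comp.IH(1)
    by (induction gs ys rule: list_all2_induct) (auto intro: evaluates_Nil evaluates_Cons)
  with computes_Comp.IH(2) show ?case using evaluates_Comp by simp
next
  case (computes_PrimRec_0 f xs z g)
  then show ?case using evaluates_PrimRec_0 by simp
next
  case (computes_PrimRec_Suc f g n xs y z)
  then show ?case using evaluates_PrimRec_Suc by simp
next
  case (computes_Mu f n xs)
  have "evaluates (pair 7 (pair (recf_encode f) m)) (list_encode xs) 0" if "m \<le> n" for m
    using that
  proof (induction m)
    case 0
    show ?case by (rule evaluates_below_0)
  next
    case (Suc m)
    then obtain v where "evaluates (recf_encode f) (list_encode (m # xs)) (Suc v)"
      using computes_Mu.IH(2) by (meson Suc_le_lessD)
    with Suc show ?case using evaluates_below_Suc by simp
  qed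
  then show ?case using computes_Mu.IH(1) evaluates_Mu by simp
qed

section \<open>Soundness of the evaluation rules\<close>

lemma recf_encode_eq_iffs:
  "recf_encode p = pair 0 a \<Longrightarrow> p = Zero"
  "recf_encode p = pair 1 a \<Longrightarrow> p = Succ"
  "recf_encode p = pair 2 a \<Longrightarrow> p = Proj a"
  "recf_encode p = pair 3 a \<Longrightarrow>
    \<exists>f gs. p = Comp f gs \<and> a = pair (recf_encode f) (list_encode (map recf_encode gs))"
  "recf_encode p = pair 4 a \<Longrightarrow> \<exists>f g. p = PrimRec f g \<and> a = pair (recf_encode f) (recf_encode g)"
  "recf_encode p = pair 5 a \<Longrightarrow> \<exists>f. p = Mu f \<and> a = recf_encode f"
  "recf_encode p \<noteq> pair 6 a"
  "recf_encode p \<noteq> pair 7 a"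
  by (cases p; simp)+

lemma list_encode_eq_iffs:
  "list_encode xs = 0 \<longleftrightarrow> xs = []"
  "list_encode xs = cons a c \<longleftrightarrow> (\<exists>ys. xs = a # ys \<and> c = list_encode ys)"
  by (cases xs; auto)+

text \<open>The invariant for the induction over derivations, with one clause for programs and one
  for each auxiliary kind. A number of none of these forms satisfies it vacuously, so junk facts do
  no harm.\<close>

definition sound :: "nat \<Rightarrow> nat \<Rightarrow> nat \<Rightarrow> bool" where
  "sound c x y \<longleftrightarrow>
    (\<forall>p xs. c = recf_encode p \<longrightarrow> x = list_encode xs \<longrightarrow> computes p xs y) \<and>
    (\<forall>gs xs. c = pair 6 (list_encode (map recf_encode gs)) \<longrightarrow> x = list_encode xs \<longrightarrow>
      (\<exists>ys. y = list_encode ys \<and> list_all2 (\<lambda>g y. computes g xs y) gs ys)) \<and>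
    (\<forall>f m xs. c = pair 7 (pair (recf_encode f) m) \<longrightarrow> x = list_encode xs \<longrightarrow>
      (\<forall>k<m. \<exists>v. computes f (k # xs) (Suc v)))"

lemma sound_programD: "sound (recf_encode p) (list_encode xs) y \<Longrightarrow> computes p xs y"
  by (simp add: sound_def)

lemma sound_listD:
  "sound (pair 6 (list_encode (map recf_encode gs))) (list_encode xs) y \<Longrightarrow>
    \<exists>ys. y = list_encode ys \<and> list_all2 (\<lambda>g y. computes g xs y) gs ys"
  by (simp add: sound_def)

lemma sound_belowD:
  "sound (pair 7 (pair (recf_encode f) m)) (list_encode xs) y \<Longrightarrow> k < m \<Longrightarrow>
    \<exists>v. computes f (k # xs) (Suc v)"
  by (simp add: sound_def)

text \<open>The auxiliary kinds carry the tags 6 and 7, so for smaller tags their clauses hold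
  vacuously.\<close>

lemma sound_programI:
  assumes "t < 6" "\<And>p xs. recf_encode p = pair t a \<Longrightarrow> x = list_encode xs \<Longrightarrow> computes p xs y"
  shows "sound (pair t a) x y"
  using assms(1) unfolding sound_def by (auto simp: prod_encode_eq intro: assms(2)[OF sym])

lemma sound_zero: "sound (pair 0 0) x 0"
  by (rule sound_programI) (auto dest!: recf_encode_eq_iffs(1) intro: computes_Zero)

lemma sound_succ: "sound (pair 1 0) (cons x 0) (Suc x)"
proof (rule sound_programI)
  fix p xs assume "recf_encode p = pair 1 0" and xs: "cons x 0 = list_encode xs"
  then have "p = Succ" by (blast dest: recf_encode_eq_iffs(2))
  moreover have "xs = [x]" using xs[symmetric] by (auto simp: list_encode_eq_iffs)
  ultimately show "computes p xs (Suc x)" by (simp add: computes_Succ)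
qed simp

lemma sound_proj_0: "sound (pair 2 0) (cons a x) a"
  by (rule sound_programI)
    (auto dest!: recf_encode_eq_iffs(3) sym[of "Suc _"] simp: list_encode_eq_iffs intro: computes_Proj0)

lemma sound_proj_Suc:
  assumes "sound (pair 2 a) x y"
  shows "sound (pair 2 (Suc a)) (cons b x) y"
proof (rule sound_programI)
  fix p xs assume "recf_encode p = pair 2 (Suc a)" and xs: "cons b x = list_encode xs"
  then have p: "p = Proj (Suc a)" by (blast dest: recf_encode_eq_iffs(3))
  obtain ys where ys: "xs = b # ys" "x = list_encode ys"
    using xs[symmetric] by (auto simp: list_encode_eq_iffs)
  have "computes (Proj a) ys y" using assms ys by (intro sound_programD) simp
  then show "computes p xs y"
    unfolding p ys(1) using computes_Proj[of "Suc a" "b # ys"]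
    by (auto elim!: computes_elims(3))
qed simp

lemma sound_comp:
  assumes "sound (pair 6 b) x c" "sound a c y"
  shows "sound (pair 3 (pair a b)) x y"
proof (rule sound_programI)
  fix p xs assume "recf_encode p = pair 3 (pair a b)" and xs: "x = list_encode xs"
  then obtain f gs where p: "p = Comp f gs" "a = recf_encode f"
    "b = list_encode (map recf_encode gs)"
    using recf_encode_eq_iffs(4) by fastforce
  obtain ys where ys: "c = list_encode ys" "list_all2 (\<lambda>g y. computes g xs y) gs ys"
    using sound_listD assms(1) unfolding p xs by blast
  then show "computes p xs y"
    using computes_Comp sound_programD assms(2) unfolding p by blast
qed simp

lemma sound_primrec_0:
  assumes "sound a x y"
  shows "sound (pair 4 (pair a b)) (cons 0 x) y"
proof (rule sound_programI)
  fix p xs assume "recf_encode p = pair 4 (pair a b)" and xs: "cons 0 x = list_encode xs"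
  then obtain f g where p: "p = PrimRec f g" "a = recf_encode f" "b = recf_encode g"
    using recf_encode_eq_iffs(5) by fastforce
  obtain ys where ys: "xs = 0 # ys" "x = list_encode ys"
    using xs[symmetric] by (auto simp: list_encode_eq_iffs)
  show "computes p xs y"
    using assms unfolding p ys by (intro computes_PrimRec_0 sound_programD)
qed simp

lemma sound_primrec_Suc:
  assumes "sound (pair 4 (pair a b)) (cons c x) d" "sound b (cons c (cons d x)) y"
  shows "sound (pair 4 (pair a b)) (cons (Suc c) x) y"
proof (rule sound_programI)
  fix p xs assume "recf_encode p = pair 4 (pair a b)" and xs: "cons (Suc c) x = list_encode xs"
  then obtain f g where p: "p = PrimRec f g" "a = recf_encode f" "b = recf_encode g"
    using recf_encode_eq_iffs(5) by fastforce
  obtain ys where ys: "xs = Suc c # ys" "x = list_encode ys"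
    using xs[symmetric] by (auto simp: list_encode_eq_iffs)
  have "computes (PrimRec f g) (c # ys) d"
    using assms(1) by (intro sound_programD) (simp add: p ys)
  moreover have "computes g (c # d # ys) y"
    using assms(2) by (intro sound_programD) (simp add: p ys)
  ultimately show "computes p xs y" unfolding p ys by (rule computes_PrimRec_Suc)
qed simp

lemma sound_mu:
  assumes "sound (pair 7 (pair a y)) x z" "sound a (cons y x) 0"
  shows "sound (pair 5 a) x y"
proof (rule sound_programI)
  fix p xs assume "recf_encode p = pair 5 a" and xs: "x = list_encode xs"
  then obtain f where p: "p = Mu f" "a = recf_encode f"
    using recf_encode_eq_iffs(6) by fastforce
  have "computes f (y # xs) 0"
    using assms(2) by (intro sound_programD) (simp add: p xs)
  then show "computes p xs y"
    using assms(1) sound_belowD unfolding p xs by (intro computes_Mu) blast+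
qed simp

lemma sound_list_Nil: "sound (pair 6 0) x 0"
  using recf_encode_eq_iffs(7)[of _ 0, symmetric] unfolding sound_def
  by (auto simp: prod_encode_eq list_encode_eq_iffs dest: sym[of 0])

lemma sound_list_Cons:
  assumes "sound a x c" "sound (pair 6 b) x d"
  shows "sound (pair 6 (cons a b)) x (cons c d)"
proof -
  have "\<exists>ys. cons c d = list_encode ys \<and> list_all2 (\<lambda>g y. computes g xs y) gs ys"
    if gs: "cons a b = list_encode (map recf_encode gs)" and xs: "x = list_encode xs" for gs xs
  proof -
    obtain g hs where hs: "gs = g # hs" "a = recf_encode g" "b = list_encode (map recf_encode hs)"
      using gs[symmetric] by (auto simp: list_encode_eq_iffs)
    obtain ys where "d = list_encode ys" "list_all2 (\<lambda>g y. computes g xs y) hs ys"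
      using sound_listD assms(2) unfolding hs xs by blast
    moreover have "computes g xs c" using sound_programD assms(1) unfolding hs xs by blast
    ultimately show ?thesis by (intro exI[of _ "c # ys"]) (simp add: hs)
  qed
  then show ?thesis
    using recf_encode_eq_iffs(7)[of _ "cons a b", symmetric] unfolding sound_def
    by (auto simp: prod_encode_eq)
qed

lemma sound_below_I:
  assumes "\<And>f xs k. a = recf_encode f \<Longrightarrow> x = list_encode xs \<Longrightarrow> k < m \<Longrightarrow>
    \<exists>v. computes f (k # xs) (Suc v)"
  shows "sound (pair 7 (pair a m)) x y"
  using recf_encode_eq_iffs(8)[of _ "pair a m", symmetric] unfolding sound_def
  by (auto simp: prod_encode_eq intro: assms)

lemma sound_below_Suc:
  assumes "sound (pair 7 (pair a b)) x z" "sound a (cons b x) (Suc y)"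
  shows "sound (pair 7 (pair a (Suc b))) x 0"
proof (rule sound_below_I)
  fix f xs k assume *: "a = recf_encode f" "x = list_encode xs" "k < Suc b"
  have "computes f (b # xs) (Suc y)"
    using assms(2) by (intro sound_programD) (simp add: *)
  then show "\<exists>v. computes f (k # xs) (Suc v)"
    using assms(1) sound_belowD * by (metis less_Suc_eq)
qed

lemma sound_if_derivable:
  "derivable eval_rule z \<Longrightarrow> sound (pfst z) (pfst (psnd z)) (psnd (psnd z))"
proof (induction rule: derivable.induct)
  case derivable_0
  have "sound (pair 0 0) (pair 0 0) 0" by (rule sound_zero)
  then show ?case by (metis pair_0_0 prod_encode_inverse fst_conv snd_conv)
next
  case (derivable_rule e)
  \<comment> \<open>Every number decodes to seven fields, so there are no ill-formed rule names; all
    tags above 10 name the last rule.\<close>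
  obtain t a b c d x y where e: "e = instance_of t a b c d x y"
    by (metis prod_decode_inverse surj_pair)
  consider "t = 0" | "t = 1" | "t = 2" | "t = 3" | "t = 4" | "t = 5" | "t = 6" | "t = 7" | "t = 8"
    | "t = 9" | "t = 10" | "t > 10"
    by (cases "t < 11") (auto simp: numeral_eq_Suc less_Suc_eq)
  then show ?case
    using derivable_rule.IH
    by cases (simp_all add: e eval_rule_simps sound_zero sound_succ sound_proj_0
      sound_proj_Suc sound_comp sound_list_Nil sound_list_Cons sound_primrec_0 sound_primrec_Suc
      sound_mu sound_below_I sound_below_Suc del: One_nat_def)
qed

text \<open>\<open>cons n 0\<close> codes the list whose only entry is \<open>n\<close>, so the
  program is run on its own code; the derivation \<open>c\<close> plays the role of a running time.
  The output 0 is the one that a decision procedure for this very set must not give on its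
  members.\<close>

definition halts_with_zero :: "nat \<Rightarrow> nat \<Rightarrow> bool" where
  "halts_with_zero n c \<longleftrightarrow> derives eval_rule c (fact n (cons n 0) 0)"

lemma computable_halts_with_zero [computable_intros]:
  "computable f \<Longrightarrow> computable g \<Longrightarrow> computable_pred (\<lambda>x. halts_with_zero (f x) (g x))"
  unfolding halts_with_zero_def by (intro computable_intros computable_eval_rule)

lemma halting_undecidable: "\<not> computable_pred (\<lambda>n. \<exists>c. halts_with_zero n c)"
proof
  assume "computable_pred (\<lambda>n. \<exists>c. halts_with_zero n c)"
  then obtain p where p: "\<And>n. computes p [n] (if \<exists>c. halts_with_zero n c then 1 else 0)"
    unfolding computable_pred_def computable_def by blast
  let ?n = "recf_encode p"
  have "(\<exists>c. halts_with_zero ?n c) \<longleftrightarrow> evaluates ?n (cons ?n 0) 0"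
    unfolding halts_with_zero_def derivable_iff_derives ..
  also have "\<dots> \<longleftrightarrow> computes p [?n] 0"
    using evaluates_if_computes[of p "[?n]" 0] sound_if_derivable[of "fact ?n (cons ?n 0) 0"]
      sound_programD[of p "[?n]" 0] by auto
  also have "\<dots> \<longleftrightarrow> \<not> (\<exists>c. halts_with_zero ?n c)"
    using p[of ?n] computes_deterministic[of p "[?n]" "Suc 0" 0] by (auto split: if_splits)
  finally show False by blast
qed

section \<open>Automata on coded inputs\<close>

definition dinit :: "nat \<Rightarrow> nat" where
  "dinit a = pfst a"

definition dtrans :: "nat \<Rightarrow> nat" where
  "dtrans a = pfst (psnd a)"

definition dacc :: "nat \<Rightarrow> nat" where
  "dacc a = psnd (psnd a)"

definition dnext :: "nat \<Rightarrow> nat \<Rightarrow> nat \<Rightarrow> nat" where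
  "dnext a q b = el (el (dtrans a) q) b"

definition daccept :: "nat \<Rightarrow> nat \<Rightarrow> bool" where
  "daccept a q \<longleftrightarrow> (\<exists>i<len (dacc a). el (dacc a) i = q)"

definition dvalid :: "nat \<Rightarrow> bool" where
  "dvalid a \<longleftrightarrow> dinit a < len (dtrans a) \<and>
    (\<forall>q<len (dtrans a). len (el (dtrans a) q) = 2 \<and>
      (\<forall>b<2. el (el (dtrans a) q) b < len (dtrans a))) \<and>
    (\<forall>i<len (dacc a). el (dacc a) i < len (dtrans a))"

definition state :: "nat \<Rightarrow> (nat \<Rightarrow> nat) \<Rightarrow> nat \<Rightarrow> nat" where
  "state a W i = rec_nat (dinit a) (\<lambda>i q. dnext a q (W i)) i"

definition decode_dfa :: "nat \<Rightarrow> dfa" where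
  "decode_dfa a = \<lparr>dfa_init = pfst a, dfa_trans = map list_decode (list_decode (pfst (psnd a))),
    dfa_accepting = list_decode (psnd (psnd a))\<rparr>"

text \<open>\<open>dfa_encode\<close> is onto, so every number codes a record and
  \<open>dvalid\<close> alone separates automata from the rest.\<close>

lemma dfa_encode_decode [simp]: "dfa_encode (decode_dfa a) = a"
  by (simp add: dfa_encode_def decode_dfa_def comp_def)

lemma mem_dfa_encode_image: "dfa_encode A \<in> dfa_encode ` X \<longleftrightarrow> A \<in> X"
  using inj_dfa_encode by (auto dest: injD)

lemma dinit_encode [simp]: "dinit (dfa_encode A) = dfa_init A"
  by (simp add: dinit_def dfa_encode_def)

lemma dtrans_encode [simp]: "dtrans (dfa_encode A) = list_encode (map list_encode (dfa_trans A))"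
  by (simp add: dtrans_def dfa_encode_def)

lemma dacc_encode [simp]: "dacc (dfa_encode A) = list_encode (dfa_accepting A)"
  by (simp add: dacc_def dfa_encode_def)

lemma daccept_encode [simp]: "daccept (dfa_encode A) q \<longleftrightarrow> q \<in> set (dfa_accepting A)"
  by (auto simp: daccept_def el_list_encode in_set_conv_nth)

lemma dnext_encode:
  assumes "is_dfa k A" "q < length (dfa_trans A)" "b < k"
  shows "dnext (dfa_encode A) q b = dfa_trans A ! q ! b"
    and "dfa_trans A ! q ! b < length (dfa_trans A)"
proof -
  have row: "length (dfa_trans A ! q) = k" "set (dfa_trans A ! q) \<subseteq> {..<length (dfa_trans A)}"
    using assms by (auto simp: is_dfa_def)
  then show "dnext (dfa_encode A) q b = dfa_trans A ! q ! b"
    using assms by (simp add: dnext_def el_list_encode)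
  show "dfa_trans A ! q ! b < length (dfa_trans A)"
    using row assms(3) nth_mem by blast
qed

lemma dvalid_encode: "dvalid (dfa_encode A) \<longleftrightarrow> is_dfa 2 A"
proof -
  have "(\<forall>row \<in> set (dfa_trans A). length row = 2 \<and> set row \<subseteq> {..<length (dfa_trans A)}) \<longleftrightarrow>
    (\<forall>q<length (dfa_trans A). length (dfa_trans A ! q) = 2 \<and>
      (\<forall>b<2. el (list_encode (dfa_trans A ! q)) b < length (dfa_trans A)))"
    unfolding all_set_conv_all_nth
    by (auto simp: el_list_encode set_conv_nth subset_eq)
  moreover have "set (dfa_accepting A) \<subseteq> {..<length (dfa_trans A)} \<longleftrightarrow>
    (\<forall>i<length (dfa_accepting A). el (list_encode (dfa_accepting A)) i < length (dfa_trans A))"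
    by (auto simp: el_list_encode set_conv_nth subset_eq)
  ultimately show ?thesis
    unfolding dvalid_def is_dfa_def by (simp add: el_list_encode cong: all_cong)
qed

lemma state_encode:
  assumes A: "is_dfa k A" and W: "range W \<subseteq> {..<k}"
  shows "state (dfa_encode A) W i = dfa_run A (prefix i W)"
proof -
  have "state (dfa_encode A) W i = dfa_run A (prefix i W) \<and>
    dfa_run A (prefix i W) < length (dfa_trans A)"
  proof (induction i)
    case 0
    then show ?case using A by (simp add: state_def dfa_run_def is_dfa_def)
  next
    case (Suc i)
    have "W i < k" using W by auto
    with Suc dnext_encode[OF A] show ?case by (simp add: state_def dfa_run_def)
  qed
  then show ?thesis ..
qed

lemma language_Int_Pref:
  assumes A: "is_dfa k A" and W: "range W \<subseteq> {..<k}"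
  shows "dfa_language k A \<inter> Pref W =
    (\<lambda>i. prefix i W) ` {i. daccept (dfa_encode A) (state (dfa_encode A) W i)}"
proof -
  have "W i < k" for i using W by auto
  then show ?thesis
    using state_encode[OF assms] by (auto simp: dfa_language_def Pref_def)
qed

lemma prefix_realizability_iff:
  assumes "range W \<subseteq> {..<2}"
  shows "a \<in> dfa_encode ` prefix_realizability 2 W \<longleftrightarrow>
    dvalid a \<and> (\<exists>i. daccept a (state a W i))"
  using language_Int_Pref[OF _ assms, of "decode_dfa a"] dvalid_encode[of "decode_dfa a"]
    mem_dfa_encode_image[of "decode_dfa a"]
  by (auto simp: prefix_realizability_def)

lemma buchi_realizability_iff:
  assumes "range W \<subseteq> {..<2}"
  shows "a \<in> dfa_encode ` buchi_realizability 2 W \<longleftrightarrow>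
    dvalid a \<and> infinite {i. daccept a (state a W i)}"
proof -
  \<comment> \<open>Prefixes taken at different positions differ in length, so counting prefixes
    amounts to counting positions.\<close>
  have "inj_on (\<lambda>i. prefix i W) X" for X
    by (rule inj_onI) (metis subsequence_length diff_zero)
  then have "infinite ((\<lambda>i. prefix i W) ` X) \<longleftrightarrow> infinite X" for X
    using finite_image_iff by blast
  then show ?thesis
    using language_Int_Pref[OF _ assms, of "decode_dfa a"] dvalid_encode[of "decode_dfa a"]
      mem_dfa_encode_image[of "decode_dfa a"]
    by (auto simp: buchi_realizability_def)
qed

section \<open>Blocks of zeros\<close>

text \<open>The length of the run of zeros that ends just before position \<open>i\<close>. Thus
  \<open>W i = 1\<close> together with \<open>zeros W i = n\<close> marks the end of the block
  \<open>n\<close>.\<close>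

definition zeros :: "(nat \<Rightarrow> nat) \<Rightarrow> nat \<Rightarrow> nat" where
  "zeros W i = rec_nat 0 (\<lambda>i c. if W i = 0 then Suc c else 0) i"

definition allowed :: "nat \<Rightarrow> nat \<Rightarrow> bool" where
  "allowed s n \<longleftrightarrow> \<not> (n < s \<and> (\<exists>c<s. halts_with_zero n c))"

text \<open>A block is judged at its final 1: one that begins before \<open>m\<close> is still
  checked if it ends inside the range, and an unfinished one is unconstrained.\<close>

definition permits :: "nat \<Rightarrow> (nat \<Rightarrow> nat) \<Rightarrow> nat \<Rightarrow> nat \<Rightarrow> bool" where
  "permits s W m n \<longleftrightarrow> (\<forall>i<n. m \<le> i \<longrightarrow> W i < 2 \<and> (W i = 1 \<longrightarrow> allowed s (zeros W i)))"

definition mem :: "nat \<Rightarrow> nat \<Rightarrow> bool" where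
  "mem I x \<longleftrightarrow> (\<exists>i<len I. el I i = x)"

text \<open>
  Since \<open>allowed s\<close> holds from \<open>s\<close> on, truncating the length of the current block at \<open>s\<close> turns
  the search for an accepted extension into a search in a finite graph; a closed set of vertices
  is a certificate that no extension is accepted.
\<close>

definition rejecting_set :: "nat \<Rightarrow> nat \<Rightarrow> nat \<Rightarrow> bool" where
  "rejecting_set s a I \<longleftrightarrow> (\<forall>q<len (dtrans a). \<forall>j<Suc s. mem I (pair q j) \<longrightarrow>
    \<not> daccept a q \<and> mem I (pair (dnext a q 0) (min (Suc j) s)) \<and>
    (allowed s j \<longrightarrow> mem I (pair (dnext a q 1) 0)))"

text \<open>A certificate for either answer. Since \<open>state a W i\<close> is the state after
  \<open>i\<close> letters, \<open>i\<close> runs up to \<open>n\<close> inclusive.\<close>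

definition decided :: "nat \<Rightarrow> nat \<Rightarrow> nat \<Rightarrow> (nat \<Rightarrow> nat) \<Rightarrow> nat \<Rightarrow> bool" where
  "decided s a I W n \<longleftrightarrow> (\<exists>i<Suc n. daccept a (state a W i)) \<or>
    rejecting_set s a I \<and> mem I (pair (state a W n) (min (zeros W n) s))"

definition shows_block :: "(nat \<Rightarrow> nat) \<Rightarrow> nat \<Rightarrow> nat \<Rightarrow> nat \<Rightarrow> bool" where
  "shows_block W k m n \<longleftrightarrow> (\<exists>i<n. m \<le> i \<and> W i = 1 \<and> zeros W i = k)"

text \<open>Stage \<open>s\<close> writes the block \<open>pfst s\<close>, so that every block gets infinitely many stages.\<close>

definition extends :: "nat \<Rightarrow> nat \<Rightarrow> nat \<Rightarrow> bool" where
  "extends s w y \<longleftrightarrow> (let v = pfst y in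
    len w < len v \<and> (\<forall>i<len w. el v i = el w i) \<and> permits s (el v) (len w) (len v) \<and>
    (allowed s (pfst s) \<longrightarrow> shows_block (el v) (pfst s) (len w) (len v)) \<and>
    (dvalid s \<longrightarrow> decided s s (psnd y) (el v) (len v)))"

text \<open>Searching for the certificate along with the prolongation makes the searched property
  computable; only the prolongation is kept.\<close>

definition stage :: "nat \<Rightarrow> nat" where
  "stage s = rec_nat 0 (\<lambda>s w. pfst (LEAST y. extends s w y)) s"

text \<open>Each stage adds at least one letter, so position \<open>i\<close> has been written by
  stage \<open>Suc i\<close>.\<close>

definition word :: "nat \<Rightarrow> nat" where
  "word i = el (stage (Suc i)) i"

section \<open>Dependence on finite parts of a word\<close>

lemma zeros_simps [simp]:
  "zeros W 0 = 0"
  "zeros W (Suc i) = (if W i = 0 then Suc (zeros W i) else 0)"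
  by (simp_all add: zeros_def)

lemma state_simps [simp]:
  "state a W 0 = dinit a"
  "state a W (Suc i) = dnext a (state a W i) (W i)"
  by (simp_all add: state_def)

lemma zeros_cong: "(\<And>j. j < i \<Longrightarrow> W j = V j) \<Longrightarrow> zeros W i = zeros V i"
  by (induction i) auto

lemma state_cong: "(\<And>j. j < i \<Longrightarrow> W j = V j) \<Longrightarrow> state a W i = state a V i"
  by (induction i) auto

lemma permits_cong:
  assumes "\<And>j. j < n \<Longrightarrow> W j = V j"
  shows "permits s W m n \<longleftrightarrow> permits s V m n"
proof -
  have "zeros W i = zeros V i" if "i < n" for i
    using that assms by (intro zeros_cong) auto
  then show ?thesis unfolding permits_def using assms by auto
qed

lemma decided_cong:
  assumes "\<And>j. j < n \<Longrightarrow> W j = V j"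
  shows "decided s a I W n \<longleftrightarrow> decided s a I V n"
proof -
  have "zeros W i = zeros V i" "state a W i = state a V i" if "i < Suc n" for i
    using that assms by (intro zeros_cong state_cong; auto)+
  then show ?thesis unfolding decided_def by auto
qed

lemma shows_block_cong:
  assumes "\<And>j. j < n \<Longrightarrow> W j = V j"
  shows "shows_block W k m n \<longleftrightarrow> shows_block V k m n"
proof -
  have "zeros W i = zeros V i" if "i < n" for i
    using that assms by (intro zeros_cong) auto
  then show ?thesis unfolding shows_block_def using assms by auto
qed

lemma zeros_add: "(\<And>i. m \<le> i \<Longrightarrow> i < m + n \<Longrightarrow> W i = 0) \<Longrightarrow> zeros W (m + n) = zeros W m + n"
  by (induction n) auto

text \<open>A letter outside the alphabet hits the default 0 of \<open>el\<close>, which is again a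
  state.\<close>

lemma dnext_less: "dvalid a \<Longrightarrow> q < len (dtrans a) \<Longrightarrow> dnext a q b < len (dtrans a)"
  by (cases "b < 2") (force simp: dvalid_def dnext_def, simp add: dvalid_def dnext_def el_def)

lemma state_less: "dvalid a \<Longrightarrow> state a W i < len (dtrans a)"
  by (induction i) (auto simp: dnext_less, simp add: dvalid_def)

section \<open>Constraints and certificates\<close>

lemma allowed_ge: "s \<le> n \<Longrightarrow> allowed s n"
  by (simp add: allowed_def)

lemma allowed_min: "allowed s (min n s) \<longleftrightarrow> allowed s n"
  by (auto simp: allowed_def min_def)

lemma allowed_antimono: "s \<le> t \<Longrightarrow> allowed t n \<Longrightarrow> allowed s n"
  unfolding allowed_def by (meson less_le_trans)

lemma permits_trans: "permits s W l m \<Longrightarrow> permits s W m n \<Longrightarrow> permits s W l n"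
  unfolding permits_def by (meson not_less)

lemma permits_antimono: "s \<le> t \<Longrightarrow> permits t W m n \<Longrightarrow> permits s W m n"
  unfolding permits_def using allowed_antimono by blast

text \<open>Without an accepted prefix up to \<open>n\<close>, the certificate must be a rejecting
  set. Every permitted letter follows an edge of the graph, so the run never leaves this closed set
  of rejecting vertices.\<close>

lemma decided_sound:
  assumes "decided s a I W n" "dvalid a" "\<And>m. permits s W n m" "daccept a (state a W i)"
  shows "\<exists>i<Suc n. daccept a (state a W i)"
proof (rule ccontr)
  assume none: "\<not> ?thesis"
  then have I: "rejecting_set s a I" "mem I (pair (state a W n) (min (zeros W n) s))"
    using assms(1) by (auto simp: decided_def)
  have step: "\<not> daccept a q \<and> mem I (pair (dnext a q 0) (min (Suc j) s)) \<and>
      (allowed s j \<longrightarrow> mem I (pair (dnext a q 1) 0))"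
    if "q < len (dtrans a)" "j < Suc s" "mem I (pair q j)" for q j
    using I(1) that unfolding rejecting_set_def by blast
  have mem: "mem I (pair (state a W (n + k)) (min (zeros W (n + k)) s))" for k
  proof (induction k)
    case 0
    then show ?case using I(2) by simp
  next
    case (Suc k)
    have "W (n + k) < 2" "W (n + k) = 1 \<longrightarrow> allowed s (zeros W (n + k))"
      using assms(3)[of "Suc (n + k)"] by (auto simp: permits_def)
    then have "W (n + k) = 0 \<or> W (n + k) = 1 \<and> allowed s (min (zeros W (n + k)) s)"
      unfolding allowed_min by linarith
    then show ?case
      using step[OF state_less[OF assms(2)] _ Suc] by (auto simp: min_def split: if_splits)
  qed
  have "\<not> daccept a (state a W (n + k))" for k
    using step[OF state_less[OF assms(2)] _ mem] by simp
  moreover have "n \<le> i" using none assms(4) by (cases "i < Suc n") auto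
  ultimately show False using assms(4) le_Suc_ex by blast
qed

lemma decided_complete:
  assumes "dvalid a"
    and none: "\<And>V m i. \<lbrakk>n \<le> m; \<And>j. j < n \<Longrightarrow> V j = W j; permits s V n m; i \<le> m\<rbrakk> \<Longrightarrow>
      \<not> daccept a (state a V i)"
  shows "\<exists>I. decided s a I W n"
proof -
  \<comment> \<open>The certificate is the set of all vertices reached by permitted continuations of
    the first \<open>n\<close> letters; truncation at \<open>s\<close> makes it finite, so it can be
    coded as a list.\<close>
  define R where "R = {pair (state a V m) (min (zeros V m) s) | V m.
    n \<le> m \<and> (\<forall>j<n. V j = W j) \<and> permits s V n m}"
  have "R \<subseteq> prod_encode ` ({..<len (dtrans a)} \<times> {..s})"
    using state_less[OF assms(1)] unfolding R_def by auto
  then have "finite R" by (rule finite_subset) auto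
  then obtain xs where xs: "set xs = R" using finite_list by blast
  define I where "I = list_encode xs"
  have I: "mem I x \<longleftrightarrow> x \<in> R" for x
    unfolding mem_def I_def xs[symmetric] in_set_conv_nth by (auto simp: el_list_encode)
  have "rejecting_set s a I"
    unfolding rejecting_set_def I
  proof (intro allI impI)
    fix q j assume "pair q j \<in> R"
    then obtain V m where V: "n \<le> m" "\<forall>j<n. V j = W j" "permits s V n m"
      and qj: "q = state a V m" "j = min (zeros V m) s"
      by (auto simp: R_def prod_encode_eq)
    \<comment> \<open>Overwriting position \<open>m\<close> appends a letter \<open>b\<close> to the
      first \<open>m\<close> letters and leaves the vertex reached there unchanged.\<close>
    have upd: "state a (V(m := b)) m = q" "zeros (V(m := b)) m = zeros V m"
      "permits s (V(m := b)) n m" for b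
      using state_cong[of m "V(m := b)" V] zeros_cong[of m "V(m := b)" V]
        permits_cong[of m "V(m := b)" V] V qj by auto
    have next_mem: "pair (dnext a q b) (min (zeros (V(m := b)) (Suc m)) s) \<in> R"
      if "b < 2" "b = 1 \<longrightarrow> allowed s (zeros V m)" for b
    proof -
      have "permits s (V(m := b)) n (Suc m)"
        using upd[of b] that unfolding permits_def by (auto simp: less_Suc_eq)
      moreover have "\<forall>j<n. (V(m := b)) j = W j" using V by auto
      moreover have "state a (V(m := b)) (Suc m) = dnext a q b" using upd by simp
      ultimately show ?thesis
        unfolding R_def using V(1) le_SucI by (intro CollectI exI conjI) auto
    qed
    show "\<not> daccept a q \<and> pair (dnext a q 0) (min (Suc j) s) \<in> R \<and>
        (allowed s j \<longrightarrow> pair (dnext a q 1) 0 \<in> R)"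
    proof (intro conjI impI)
      show "\<not> daccept a q" using none V qj by blast
      have "min (zeros (V(m := 0)) (Suc m)) s = min (Suc j) s"
        using upd(2)[of 0] qj by auto
      then show "pair (dnext a q 0) (min (Suc j) s) \<in> R" using next_mem[of 0] by simp
      assume "allowed s j"
      then have "allowed s (zeros V m)" unfolding qj allowed_min .
      then show "pair (dnext a q 1) 0 \<in> R" using next_mem[of 1] by simp
    qed
  qed
  moreover have "permits s W n n" by (simp add: permits_def)
  then have "mem I (pair (state a W n) (min (zeros W n) s))"
    unfolding I R_def by blast
  ultimately show ?thesis unfolding decided_def by blast
qed

text \<open>The first \<open>m\<close> letters may end inside a block, which has to be closed first.
  Padding it with \<open>s\<close> zeros gives it length at least \<open>s\<close>, hence an allowed
  one; after its 1 the block \<open>k\<close> can be written.\<close>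

lemma ex_shows_block:
  assumes "allowed s k"
  shows "\<exists>V n. m < n \<and> (\<forall>i<m. V i = W i) \<and> permits s V m n \<and> shows_block V k m n"
proof -
  define V where "V = (\<lambda>i. if i < m then W i else if i = m + s \<or> i = Suc (m + s) + k then 1 else 0)"
  let ?n = "Suc (Suc (m + s) + k)"
  have 1: "zeros V (m + s) = zeros V m + s"
    by (rule zeros_add) (auto simp: V_def)
  have "zeros V (Suc (m + s) + k) = zeros V (Suc (m + s)) + k"
    by (rule zeros_add) (auto simp: V_def)
  then have 2: "zeros V (Suc (m + s) + k) = k"
    by (simp add: V_def)
  have "V i < 2 \<and> (V i = 1 \<longrightarrow> allowed s (zeros V i))" if "m \<le> i" for i
  proof -
    consider "i = m + s" | "i = Suc (m + s) + k" | "i \<noteq> m + s" "i \<noteq> Suc (m + s) + k"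
      by blast
    then show ?thesis
      using 1 2 assms that by cases (auto simp: V_def intro: allowed_ge)
  qed
  then have "permits s V m ?n" by (simp add: permits_def)
  moreover have "shows_block V k m ?n"
    unfolding shows_block_def using 2 by (intro exI[of _ "Suc (m + s) + k"]) (simp add: V_def)
  moreover have "\<forall>i<m. V i = W i" by (simp add: V_def)
  moreover have "m < ?n" by simp
  ultimately show ?thesis by blast
qed

lemma ex_extends: "\<exists>y. extends s w y"
proof -
  define m where "m = len w"
  have "\<exists>V n. m < n \<and> (\<forall>i<m. V i = el w i) \<and> permits s V m n \<and>
    (allowed s (pfst s) \<longrightarrow> shows_block V (pfst s) m n)"
  proof (cases "allowed s (pfst s)")
    case True
    then show ?thesis using ex_shows_block[of s "pfst s" m "el w"] by blast
  next
    case False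
    \<comment> \<open>A single 0 ends no block, so it is always permitted; it only serves to make
      the word strictly longer.\<close>
    have "permits s (\<lambda>i. if i < m then el w i else 0) m (Suc m)" by (simp add: permits_def)
    with False show ?thesis
      by (intro exI[of _ "\<lambda>i. if i < m then el w i else 0"] exI[of _ "Suc m"]) simp
  qed
  then obtain V n where V: "m < n" "\<forall>i<m. V i = el w i" "permits s V m n"
    "allowed s (pfst s) \<longrightarrow> shows_block V (pfst s) m n" by blast
  have "\<exists>V n I. m < n \<and> (\<forall>i<m. V i = el w i) \<and> permits s V m n \<and>
    (allowed s (pfst s) \<longrightarrow> shows_block V (pfst s) m n) \<and> (dvalid s \<longrightarrow> decided s s I V n)"
  proof (cases "dvalid s \<and> (\<exists>V' n' i. n \<le> n' \<and> (\<forall>j<n. V' j = V j) \<and> permits s V' n n' \<and>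
      i \<le> n' \<and> daccept s (state s V' i))")
    case True
    then obtain V' n' i where V': "n \<le> n'" "\<forall>j<n. V' j = V j" "permits s V' n n'"
      "i \<le> n'" "daccept s (state s V' i)" by blast
    have "permits s V' m n" "shows_block V' (pfst s) m n \<longleftrightarrow> shows_block V (pfst s) m n"
      using permits_cong[of n V' V] shows_block_cong[of n V' V] V V' by auto
    then have "permits s V' m n'" "allowed s (pfst s) \<longrightarrow> shows_block V' (pfst s) m n'"
      using permits_trans V V' unfolding shows_block_def by (blast, meson less_le_trans)
    \<comment> \<open>The certificate 0 is a dummy: the accepted prefix already decides the
      question.\<close>
    moreover have "decided s s 0 V' n'" using V' unfolding decided_def by (metis less_Suc_eq_le)
    moreover have "\<forall>i<m. V' i = el w i" "m < n'" using V V' by auto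
    ultimately show ?thesis by blast
  next
    case False
    have "dvalid s \<longrightarrow> (\<exists>I. decided s s I V n)"
    proof
      assume "dvalid s"
      then show "\<exists>I. decided s s I V n" using False by (intro decided_complete) blast+
    qed
    with V show ?thesis by blast
  qed
  then obtain V n I where V: "m < n" "\<forall>i<m. V i = el w i" "permits s V m n"
    "allowed s (pfst s) \<longrightarrow> shows_block V (pfst s) m n" "dvalid s \<longrightarrow> decided s s I V n" by blast
  define v where "v = list_encode (map V [0..<n])"
  have v: "len v = n" "\<And>i. i < n \<Longrightarrow> el v i = V i" by (auto simp: v_def el_list_encode)
  have "extends s w (pair v I)"
    unfolding extends_def
    using V v permits_cong[of n "el v" V] shows_block_cong[of n "el v" V]
      decided_cong[of n "el v" V] by (auto simp: m_def Let_def)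
  then show ?thesis ..
qed

section \<open>The limit word\<close>

lemma stage_Suc:
  obtains I where "extends s (stage s) (pair (stage (Suc s)) I)"
proof
  have "extends s (stage s) (LEAST y. extends s (stage s) y)"
    using ex_extends by (rule LeastI_ex)
  then show "extends s (stage s) (pair (stage (Suc s)) (psnd (LEAST y. extends s (stage s) y)))"
    by (simp add: stage_def)
qed

lemma len_stage_less: "len (stage s) < len (stage (Suc s))"
  by (rule stage_Suc[of s]) (simp add: extends_def Let_def)

lemma len_stage_ge: "s \<le> len (stage s)"
proof (induction s)
  case (Suc s)
  then show ?case using len_stage_less[of s] by simp
qed simp

lemma len_stage_mono: "s \<le> t \<Longrightarrow> len (stage s) \<le> len (stage t)"
  by (rule lift_Suc_mono_le) (use len_stage_less in \<open>auto intro: less_imp_le\<close>)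

lemma el_stage_mono: "s \<le> t \<Longrightarrow> i < len (stage s) \<Longrightarrow> el (stage t) i = el (stage s) i"
proof (induction t rule: dec_induct)
  case (step t)
  have i: "i < len (stage t)" using step len_stage_mono less_le_trans by blast
  have "el (stage (Suc t)) i = el (stage t) i"
    by (rule stage_Suc[of t]) (simp add: extends_def Let_def i)
  with step show ?case by simp
qed simp

lemma word_eq_el_stage: "i < len (stage s) \<Longrightarrow> word i = el (stage s) i"
  unfolding word_def
  by (metis el_stage_mono len_stage_ge Suc_le_lessD nat_le_linear)

lemma word_extends:
  obtains I where
    "permits s word (len (stage s)) (len (stage (Suc s)))"
    "allowed s (pfst s) \<longrightarrow> shows_block word (pfst s) (len (stage s)) (len (stage (Suc s)))"
    "dvalid s \<longrightarrow> decided s s I word (len (stage (Suc s)))"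
proof (rule stage_Suc[of s])
  fix I assume "extends s (stage s) (pair (stage (Suc s)) I)"
  then show thesis
    using that[of I] word_eq_el_stage[of _ "Suc s"]
      permits_cong[of "len (stage (Suc s))" word "el (stage (Suc s))"]
      shows_block_cong[of "len (stage (Suc s))" word "el (stage (Suc s))"]
      decided_cong[of "len (stage (Suc s))" word "el (stage (Suc s))"]
    by (simp add: extends_def Let_def)
qed

lemma word_permits: "permits s word (len (stage s)) n"
proof -
  have "permits s word (len (stage s)) (len (stage (s + k)))" for k
  proof (induction k)
    case 0
    then show ?case by (simp add: permits_def)
  next
    case (Suc k)
    have "permits s word (len (stage (s + k))) (len (stage (Suc (s + k))))"
      by (rule word_extends[of "s + k"]) (rule permits_antimono[of s "s + k"]; simp)
    with Suc permits_trans show ?case by auto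
  qed
  moreover have "n \<le> len (stage (s + n))" using len_stage_ge[of "s + n"] by simp
  ultimately show ?thesis unfolding permits_def by (meson less_le_trans)
qed

lemma word_less: "word i < 2"
proof -
  have "len (stage 0) = 0" by (simp add: stage_def len_def)
  then show ?thesis using word_permits[of 0 "Suc i"] by (simp add: permits_def)
qed

text \<open>All later letters are permitted by the constraints of stage \<open>a\<close>, so the
  certificate found there speaks about the whole word and an unbounded question becomes a bounded
  one.\<close>

lemma word_accepts_iff:
  assumes "dvalid a"
  shows "(\<exists>i. daccept a (state a word i)) \<longleftrightarrow>
    (\<exists>i<Suc (len (stage (Suc a))). daccept a (state a word i))"
proof (rule word_extends[of a])
  fix I assume I: "dvalid a \<longrightarrow> decided a a I word (len (stage (Suc a)))"
  have "permits a word (len (stage (Suc a))) m" for m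
    using word_permits permits_antimono le_SucI by blast
  then show ?thesis using decided_sound I assms by blast
qed

lemma infinite_block_iff:
  "infinite {i. word i = 1 \<and> zeros word i = n} \<longleftrightarrow> \<not> (\<exists>c. halts_with_zero n c)"
proof
  assume inf: "infinite {i. word i = 1 \<and> zeros word i = n}"
  show "\<not> (\<exists>c. halts_with_zero n c)"
  proof
    assume "\<exists>c. halts_with_zero n c"
    then obtain c where c: "halts_with_zero n c" by blast
    \<comment> \<open>The first stage whose bounds exceed both the block \<open>n\<close> and the
      witness \<open>c\<close>; from then on \<open>n\<close> is forbidden.\<close>
    let ?s = "Suc (max n c)"
    have "n < ?s" "c < ?s" by auto
    then have "\<not> allowed ?s n" unfolding allowed_def using c by blast
    then have "i < len (stage ?s)" if "word i = 1" "zeros word i = n" for i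
      using word_permits[of ?s "Suc i"] that by (auto simp: permits_def not_less[symmetric])
    then have "{i. word i = 1 \<and> zeros word i = n} \<subseteq> {..<len (stage ?s)}" by blast
    with inf show False using finite_subset by blast
  qed
next
  assume "\<not> (\<exists>c. halts_with_zero n c)"
  then have allowed: "allowed s n" for s by (simp add: allowed_def)
  \<comment> \<open>Stage \<open>pair n m\<close> writes the block \<open>n\<close>, and it starts
    at a position that is at least \<open>pair n m\<close>, hence at least \<open>m\<close>.\<close>
  have "\<exists>i\<ge>m. word i = 1 \<and> zeros word i = n" for m
  proof (rule word_extends[of "pair n m"])
    assume "allowed (pair n m) (pfst (pair n m)) \<longrightarrow> shows_block word (pfst (pair n m))
      (len (stage (pair n m))) (len (stage (Suc (pair n m))))"
    then obtain i where "len (stage (pair n m)) \<le> i" "word i = 1" "zeros word i = n"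
      using allowed by (auto simp: shows_block_def)
    moreover have "m \<le> len (stage (pair n m))"
      using len_stage_ge le_prod_encode_2 le_trans by blast
    ultimately show ?thesis using le_trans by blast
  qed
  then show "infinite {i. word i = 1 \<and> zeros word i = n}"
    unfolding infinite_nat_iff_unbounded_le by blast
qed

section \<open>Computability of the word\<close>

lemma computable_dinit [computable_intros]: "computable f \<Longrightarrow> computable (\<lambda>x. dinit (f x))"
  unfolding dinit_def by (intro computable_intros)

lemma computable_dtrans [computable_intros]: "computable f \<Longrightarrow> computable (\<lambda>x. dtrans (f x))"
  unfolding dtrans_def by (intro computable_intros)

lemma computable_dacc [computable_intros]: "computable f \<Longrightarrow> computable (\<lambda>x. dacc (f x))"
  unfolding dacc_def by (intro computable_intros)

lemma computable_dnext [computable_intros]: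
  "computable f \<Longrightarrow> computable g \<Longrightarrow> computable h \<Longrightarrow> computable (\<lambda>x. dnext (f x) (g x) (h x))"
  unfolding dnext_def by (intro computable_intros)

lemma computable_pred_daccept [computable_intros]:
  assumes "computable f" "computable g"
  shows "computable_pred (\<lambda>x. daccept (f x) (g x))"
proof -
  have "computable_pred (\<lambda>x. daccept (pfst x) (psnd x))"
    unfolding daccept_def by (intro computable_intros)
  from computable_pred_comp[OF this computable_pair[OF assms]] show ?thesis by simp
qed

lemma computable_pred_dvalid [computable_intros]:
  assumes "computable f"
  shows "computable_pred (\<lambda>x. dvalid (f x))"
proof -
  have "computable_pred dvalid"
    unfolding dvalid_def[abs_def] by (intro computable_intros)
  from computable_pred_comp[OF this assms] show ?thesis .
qed

lemma computable_state_el [computable_intros]: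
  assumes "computable f" "computable g" "computable h"
  shows "computable (\<lambda>x. state (f x) (el (g x)) (h x))"
proof -
  have "computable (\<lambda>x. state (pfst x) (el (pfst (psnd x))) (psnd (psnd x)))"
    unfolding state_def by (intro computable_intros)
  from computable_comp[OF this computable_pair[OF assms(1) computable_pair[OF assms(2,3)]]]
  show ?thesis by simp
qed

lemma computable_zeros_el [computable_intros]:
  assumes "computable g" "computable h"
  shows "computable (\<lambda>x. zeros (el (g x)) (h x))"
proof -
  have "computable (\<lambda>x. zeros (el (pfst x)) (psnd x))"
    unfolding zeros_def by (intro computable_intros)
  from computable_comp[OF this computable_pair[OF assms]] show ?thesis by simp
qed

lemma computable_pred_allowed [computable_intros]:
  assumes "computable f" "computable g"
  shows "computable_pred (\<lambda>x. allowed (f x) (g x))"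
proof -
  have "computable_pred (\<lambda>x. allowed (pfst x) (psnd x))"
    unfolding allowed_def by (intro computable_intros)
  from computable_pred_comp[OF this computable_pair[OF assms]] show ?thesis by simp
qed

lemma computable_pred_mem [computable_intros]:
  assumes "computable f" "computable g"
  shows "computable_pred (\<lambda>x. mem (f x) (g x))"
proof -
  have "computable_pred (\<lambda>x. mem (pfst x) (psnd x))"
    unfolding mem_def by (intro computable_intros)
  from computable_pred_comp[OF this computable_pair[OF assms]] show ?thesis by simp
qed

text \<open>All quantifiers are bounded here: the certificate inside the third argument replaces the
  search over all extensions.\<close>

lemma computable_pred_extends: "computable_pred (\<lambda>e. extends (pfst (pfst e)) (psnd (pfst e)) (psnd e))"
  unfolding extends_def Let_def permits_def shows_block_def decided_def rejecting_set_def
  by (intro computable_intros)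

lemma computable_stage [computable_intros]:
  assumes "computable f"
  shows "computable (\<lambda>x. stage (f x))"
proof -
  have least: "computable (\<lambda>x. LEAST y. extends (pfst x) (psnd x) y)"
    by (rule computable_Least[OF computable_pred_extends ex_extends])
  \<comment> \<open>The recursion rule expects the counter and the previous value in the second
    component of the environment.\<close>
  have "computable (\<lambda>e. LEAST y. extends (pfst (psnd e)) (psnd (psnd e)) y)"
    by (rule computable_comp[OF least]) (intro computable_intros)
  then have "computable stage"
    unfolding stage_def[abs_def] by (intro computable_intros)
  from computable_comp[OF this assms] show ?thesis .
qed

lemma computable_word: "computable word"
  unfolding word_def[abs_def] by (intro computable_intros)

section \<open>Automata recognizing the end of a block\<close>

text \<open>The states up to \<open>n\<close> count zeros, \<open>n + 1\<close> means too many
  zeros, and \<open>n + 2\<close> means that the block \<open>n\<close> has just ended; apart from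
  being accepting, \<open>n + 2\<close> behaves like 0.\<close>

definition block_dfa :: "nat \<Rightarrow> dfa" where
  "block_dfa n = \<lparr>dfa_init = 0,
    dfa_trans = map (\<lambda>q. let c = (if q = n + 2 then 0 else q) in
      [if c \<le> n then Suc c else c, if c = n then n + 2 else 0]) [0..<n + 3],
    dfa_accepting = [n + 2]\<rparr>"

lemma is_dfa_block_dfa: "is_dfa 2 (block_dfa n)"
  by (auto simp: is_dfa_def block_dfa_def Let_def)

text \<open>This makes \<open>block_dfa\<close> a many-one reduction to the Buchi problem.\<close>

lemma computable_block_dfa: "computable (\<lambda>n. dfa_encode (block_dfa n))"
proof -
  have "dfa_encode (block_dfa n) = pair 0 (pair
    (list_encode (map (\<lambda>q. cons (if (if q = n + 2 then 0 else q) \<le> n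
          then Suc (if q = n + 2 then 0 else q) else (if q = n + 2 then 0 else q))
        (cons (if (if q = n + 2 then 0 else q) = n then n + 2 else 0) 0)) [0..<n + 3]))
    (cons (n + 2) 0))" for n
    by (simp add: dfa_encode_def block_dfa_def Let_def comp_def del: upt_Suc cong: if_cong)
  then show ?thesis
    by (simp only:) (intro computable_intros computable_list_encode_map_upt)
qed

lemma state_block_dfa:
  assumes "\<And>i. W i < 2"
  shows "state (dfa_encode (block_dfa n)) W i =
    (if i > 0 \<and> W (i - 1) = 1 \<and> zeros W (i - 1) = n then n + 2 else min (zeros W i) (Suc n))"
proof (induction i)
  case 0
  then show ?case by (simp add: block_dfa_def)
next
  case (Suc i)
  have dnext: "dnext (dfa_encode (block_dfa n)) q b = (let c = (if q = n + 2 then 0 else q) in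
      [if c \<le> n then Suc c else c, if c = n then n + 2 else 0] ! b)" if "q < n + 3" "b < 2" for q b
    using dnext_encode(1)[OF is_dfa_block_dfa, of q n b] that
    by (simp add: block_dfa_def Let_def del: upt_Suc)
  let ?q = "state (dfa_encode (block_dfa n)) W i"
  \<comment> \<open>State \<open>n + 2\<close> occurs only right after a 1, where the count of zeros
    is 0; replacing it by 0 therefore yields the truncated count in both cases.\<close>
  have q: "?q < n + 3" "(if ?q = n + 2 then 0 else ?q) = min (zeros W i) (Suc n)"
    unfolding Suc by (cases i; auto)+
  have "W i = 0 \<or> W i = 1" using assms[of i] by linarith
  then show ?case
    using dnext[OF q(1) assms[of i]] unfolding q(2) Let_def by auto
qed

lemma block_dfa_realizable_iff:
  "dfa_encode (block_dfa n) \<in> dfa_encode ` buchi_realizability 2 word \<longleftrightarrow>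
    \<not> (\<exists>c. halts_with_zero n c)"
proof -
  \<comment> \<open>The state after \<open>Suc i\<close> letters reflects the letter at position
    \<open>i\<close>, hence the shift by \<open>Suc\<close>.\<close>
  have "daccept (dfa_encode (block_dfa n)) (state (dfa_encode (block_dfa n)) word i) \<longleftrightarrow>
      i \<in> Suc ` {i. word i = 1 \<and> zeros word i = n}" for i
    unfolding state_block_dfa[OF word_less]
    by (cases i) (auto simp: block_dfa_def)
  then have "{i. daccept (dfa_encode (block_dfa n)) (state (dfa_encode (block_dfa n)) word i)} =
      Suc ` {i. word i = 1 \<and> zeros word i = n}" by blast
  moreover have "range word \<subseteq> {..<2}" using word_less by auto
  ultimately show ?thesis
    using buchi_realizability_iff dvalid_encode is_dfa_block_dfa infinite_block_iff
    by (simp add: finite_image_iff del: One_nat_def)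
qed

theorem theorem1:
  shows "\<exists>(k :: nat) (W :: nat word).
    range W \<subseteq> {..<k} \<and> computable W \<and> prefix_decidable k W \<and> \<not> buchi_decidable k W"
proof (intro exI conjI)
  show range: "range word \<subseteq> {..<2}" using word_less by auto
  show "computable word" by (rule computable_word)
  \<comment> \<open>Up to the bound, the run reads only letters of the coded finite word, for which
    the computability rules are available.\<close>
  have "state a word i = state a (el (stage (Suc a))) i" if "i < Suc (len (stage (Suc a)))" for a i
    using that word_eq_el_stage by (intro state_cong) auto
  then have "a \<in> dfa_encode ` prefix_realizability 2 word \<longleftrightarrow> dvalid a \<and>
      (\<exists>i<Suc (len (stage (Suc a))). daccept a (state a (el (stage (Suc a))) i))" for a
    unfolding prefix_realizability_iff[OF range] using word_accepts_iff by metis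
  moreover have "computable_pred (\<lambda>a. dvalid a \<and>
      (\<exists>i<Suc (len (stage (Suc a))). daccept a (state a (el (stage (Suc a))) i)))"
    by (intro computable_intros)
  ultimately show "prefix_decidable 2 word"
    unfolding prefix_decidable_def decidable_def computable_pred_def by simp
  show "\<not> buchi_decidable 2 word"
  proof
    assume "buchi_decidable 2 word"
    then have "computable_pred (\<lambda>a. a \<in> dfa_encode ` buchi_realizability 2 word)"
      unfolding buchi_decidable_def decidable_def computable_pred_def .
    \<comment> \<open>The reduction maps the complement of the undecidable set to the positive
      instances, hence the negation.\<close>
    from computable_pred_not[OF computable_pred_comp[OF this computable_block_dfa]]
    show False
      unfolding block_dfa_realizable_iff using halting_undecidable by simp
  qed
qed

end
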